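(* Let $G$ be a cyclic group of order $|G|=p_1^{n_1}\cdots p_s^{n_s}$ ($s\ge 1$), where $p_1,\ldots,p_s$ are pairwise distinct primes, $n_1\ge 3$, and, if $s\ge 2$, $n_2\ge 2,\ldots,n_s\ge 2$. Let $m$ be a natural number coprime to $|G|$ and put $d=m\cdot|G|$. Then there exists a torsionfree indecomposable classical crystallographic group of dimension $d$ with holonomy group isomorphic to $G$.
   Context: Let $G$ be a finite group and $M$ a $\mathbb{Z}G$-module which is free of finite rank as a $\mathbb{Z}$-module and on which $G$ acts faithfully. Let $\mathbb{R}M=\mathbb{R}\otimes_{\mathbb{Z}}M$, regarded as containing $M$ as a full lattice, with the induced linear action of $G$, and let $\widehat{M}=\mathbb{R}M/M$ be the quotient of additive groups with action $g(x+M)=g(x)+M$. A $1$-cocycle is a map $T:G\to\widehat{M}$ with $T(gh)=gT(h)+T(g)$ for all $g,h\in G$; it is a coboundary (cohomologous to $0$) if there is $z\in\widehat{M}$ with $T(g)=(g-1)z$ for all $g\in G$. Regarding each value $T(g)$ (a coset of $M$) as a subset of $\mathbb{R}M$, define the group $$\mathfrak{Crys}(G;M;T)=\{(g,x)\mid g\in G,\ x\in T(g)\},\qquad (g,x)(g',x')=(gg',\,gx'+x).$$ A classical crystallographic group with holonomy group $G$ is (up to isomorphism) a group of this form; its dimension is the $\mathbb{Z}$-rank of $M$. When $T$ is not cohomologous to $0$, the group $\mathfrak{Crys}(G;M;T)$ is called indecomposable if $M$ is an indecomposable $\mathbb{Z}G$-module. Torsionfree means that the group has no nontrivial element of finite order.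 *)

theory Defs
  imports
    "HOL-Algebra.Elementary_Groups"
    "HOL-Computational_Algebra.Primes"
    "Jordan_Normal_Form.VS_Connect"
begin

text \<open>
  A \<open>\<int>G\<close>-module \<open>M\<close> that is free of rank \<open>d\<close> over \<open>\<int>\<close> is given as a full lattice in its
  scalar extension \<open>\<real>M\<close>, which is identified with \<open>\<real>\<^sup>d\<close> (\<open>carrier_vec d\<close>).  The action of \<open>G\<close> on
  \<open>M\<close> extends uniquely to a linear action on \<open>\<real>M\<close>; that action is given by real matrices \<open>\<rho> g\<close>
  mapping \<open>M\<close> into itself.  \<open>M\<close> need not be the standard lattice.
\<close>

abbreviation RM :: "nat \<Rightarrow> real vec monoid" where
  "RM d \<equiv> monoid_vec TYPE(real) d"

definition full_lattice :: "nat \<Rightarrow> real vec set \<Rightarrow> bool" where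
  "full_lattice d M \<longleftrightarrow>
     (\<exists>B. finite B \<and> vectorspace.basis class_ring (module_vec TYPE(real) d) B \<and>
          M = {module.lincomb (module_vec TYPE(real) d) (\<lambda>b. real_of_int (a b)) B | a. True})"

definition ZG_lattice ::
  "('g, 'b) monoid_scheme \<Rightarrow> nat \<Rightarrow> ('g \<Rightarrow> real mat) \<Rightarrow> real vec set \<Rightarrow> bool" where
  "ZG_lattice G d \<rho> M \<longleftrightarrow>
     full_lattice d M \<and>
     (\<forall>g\<in>carrier G. \<rho> g \<in> carrier_mat d d) \<and>
     \<rho> \<one>\<^bsub>G\<^esub> = 1\<^sub>m d \<and>
     (\<forall>g\<in>carrier G. \<forall>h\<in>carrier G. \<rho> (g \<otimes>\<^bsub>G\<^esub> h) = \<rho> g * \<rho> h) \<and>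
     (\<forall>g\<in>carrier G. \<forall>x\<in>M. \<rho> g *\<^sub>v x \<in> M)"

definition faithful_on ::
  "('g, 'b) monoid_scheme \<Rightarrow> ('g \<Rightarrow> real mat) \<Rightarrow> real vec set \<Rightarrow> bool" where
  "faithful_on G \<rho> M \<longleftrightarrow>
     (\<forall>g\<in>carrier G. (\<forall>x\<in>M. \<rho> g *\<^sub>v x = x) \<longrightarrow> g = \<one>\<^bsub>G\<^esub>)"

definition ZG_submodule ::
  "('g, 'b) monoid_scheme \<Rightarrow> nat \<Rightarrow> ('g \<Rightarrow> real mat) \<Rightarrow> real vec set \<Rightarrow> real vec set \<Rightarrow> bool" where
  "ZG_submodule G d \<rho> M N \<longleftrightarrow>
     N \<subseteq> M \<and> subgroup N (RM d) \<and> (\<forall>g\<in>carrier G. \<forall>x\<in>N. \<rho> g *\<^sub>v x \<in> N)"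

definition indecomposable_module ::
  "('g, 'b) monoid_scheme \<Rightarrow> nat \<Rightarrow> ('g \<Rightarrow> real mat) \<Rightarrow> real vec set \<Rightarrow> bool" where
  "indecomposable_module G d \<rho> M \<longleftrightarrow>
     M \<noteq> {0\<^sub>v d} \<and>
     (\<forall>N\<^sub>1 N\<^sub>2. ZG_submodule G d \<rho> M N\<^sub>1 \<and> ZG_submodule G d \<rho> M N\<^sub>2 \<and>
        N\<^sub>1 \<inter> N\<^sub>2 = {0\<^sub>v d} \<and> N\<^sub>1 <#>\<^bsub>RM d\<^esub> N\<^sub>2 = M \<longrightarrow>
        N\<^sub>1 = {0\<^sub>v d} \<or> N\<^sub>2 = {0\<^sub>v d})"

text \<open>
  The quotient \<open>\<real>M / M\<close> is the factor group \<open>RM d Mod M\<close>, whose elements are the cosets of \<open>M\<close>,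
  i.e. subsets of \<open>\<real>M\<close>; its multiplication is addition of cosets.  An element \<open>g\<close> acts on a coset
  by taking its image, as \<open>\<rho> g\<close> maps \<open>M\<close> onto \<open>M\<close>.
\<close>

definition coset_act :: "('g \<Rightarrow> real mat) \<Rightarrow> 'g \<Rightarrow> real vec set \<Rightarrow> real vec set" where
  "coset_act \<rho> g X = (\<lambda>x. \<rho> g *\<^sub>v x) ` X"

definition cocycle ::
  "('g, 'b) monoid_scheme \<Rightarrow> nat \<Rightarrow> ('g \<Rightarrow> real mat) \<Rightarrow> real vec set \<Rightarrow> ('g \<Rightarrow> real vec set) \<Rightarrow> bool"
where
  "cocycle G d \<rho> M T \<longleftrightarrow>
     T \<in> carrier G \<rightarrow> carrier (RM d Mod M) \<and>
     (\<forall>g\<in>carrier G. \<forall>h\<in>carrier G.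
        T (g \<otimes>\<^bsub>G\<^esub> h) = coset_act \<rho> g (T h) \<otimes>\<^bsub>RM d Mod M\<^esub> T g)"

definition coboundary ::
  "('g, 'b) monoid_scheme \<Rightarrow> nat \<Rightarrow> ('g \<Rightarrow> real mat) \<Rightarrow> real vec set \<Rightarrow> ('g \<Rightarrow> real vec set) \<Rightarrow> bool"
where
  "coboundary G d \<rho> M T \<longleftrightarrow>
     (\<exists>z\<in>carrier (RM d Mod M). \<forall>g\<in>carrier G.
        T g = coset_act \<rho> g z \<otimes>\<^bsub>RM d Mod M\<^esub> inv\<^bsub>RM d Mod M\<^esub> z)"

definition Crys ::
  "('g, 'b) monoid_scheme \<Rightarrow> nat \<Rightarrow> ('g \<Rightarrow> real mat) \<Rightarrow> ('g \<Rightarrow> real vec set) \<Rightarrow> ('g \<times> real vec) monoid"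
where
  "Crys G d \<rho> T =
     \<lparr>carrier = {(g, x). g \<in> carrier G \<and> x \<in> T g},
      mult = (\<lambda>(g, x) (g', x'). (g \<otimes>\<^bsub>G\<^esub> g', \<rho> g *\<^sub>v x' + x)),
      one = (\<one>\<^bsub>G\<^esub>, 0\<^sub>v d)\<rparr>"

text \<open>
  \<open>crystallographic G d \<rho> M T\<close>: the data define a classical crystallographic group
  \<open>Crys G d \<rho> T\<close> of dimension \<open>d\<close> with holonomy group \<open>G\<close>.
\<close>

definition crystallographic ::
  "('g, 'b) monoid_scheme \<Rightarrow> nat \<Rightarrow> ('g \<Rightarrow> real mat) \<Rightarrow> real vec set \<Rightarrow> ('g \<Rightarrow> real vec set) \<Rightarrow> bool"
where
  "crystallographic G d \<rho> M T \<longleftrightarrow>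
     group G \<and> finite (carrier G) \<and>
     ZG_lattice G d \<rho> M \<and> faithful_on G \<rho> M \<and> cocycle G d \<rho> M T"

definition indecomposable_crystallographic ::
  "('g, 'b) monoid_scheme \<Rightarrow> nat \<Rightarrow> ('g \<Rightarrow> real mat) \<Rightarrow> real vec set \<Rightarrow> ('g \<Rightarrow> real vec set) \<Rightarrow> bool"
where
  "indecomposable_crystallographic G d \<rho> M T \<longleftrightarrow>
     crystallographic G d \<rho> M T \<and> \<not> coboundary G d \<rho> M T \<and> indecomposable_module G d \<rho> M"

definition torsionfree :: "('a, 'b) monoid_scheme \<Rightarrow> bool" where
  "torsionfree H \<longleftrightarrow>
     (\<forall>x\<in>carrier H. \<forall>k::nat. k > 0 \<and> x [^]\<^bsub>H\<^esub> k = \<one>\<^bsub>H\<^esub> \<longrightarrow> x = \<one>\<^bsub>H\<^esub>)"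

lemma full_lattice_subgroup:
  assumes "full_lattice d M"
  shows "subgroup M (RM d)"
proof -
  interpret vs: vec_space "TYPE(real)" d .
  obtain B where fin: "finite B" and bas: "vs.basis B"
    and M: "M = {vs.lincomb (\<lambda>b. real_of_int (a b)) B | a. True}"
    using assms unfolding full_lattice_def by blast
  have B: "B \<subseteq> carrier_vec d"
    using bas by (simp add: vs.basis_def)
  interpret R: comm_group "RM d" by (rule comm_group_vec)
  have carr: "x \<in> carrier_vec d" if "x \<in> M" for x
    using that B unfolding M by auto
  have idx: "vs.lincomb a B $ i = (\<Sum>b\<in>B. a b * b $ i)" if "i < d" for a i
    using vs.lincomb_index[OF that B] by simp
  have dim [simp]: "dim_vec (vs.lincomb a B) = d" for a
    using vs.lincomb_dim[OF fin B] by simp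
  have mem: "vs.lincomb (\<lambda>b. real_of_int (a b)) B \<in> M" for a
    unfolding M by blast
  show ?thesis
  proof (rule R.subgroupI)
    show "M \<subseteq> carrier (RM d)"
      using carr by (auto simp: monoid_vec_simps)
    show "M \<noteq> {}"
      unfolding M by blast
    show "inv\<^bsub>RM d\<^esub> x \<in> M" if xM: "x \<in> M" for x
    proof -
      obtain a where a: "x = vs.lincomb (\<lambda>b. real_of_int (a b)) B"
        using xM unfolding M by blast
      have x: "x \<in> carrier_vec d"
        using carr xM .
      have "inv\<^bsub>RM d\<^esub> x = - x"
        by (rule R.inv_equality) (use x in \<open>auto simp: monoid_vec_simps\<close>)
      also have "- x = vs.lincomb (\<lambda>b. real_of_int (- a b)) B"
        by (rule eq_vecI) (use x B a in \<open>auto simp: idx sum_negf\<close>)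
      finally show ?thesis
        using mem[of "\<lambda>b. - a b"] by simp
    qed
    show "x \<otimes>\<^bsub>RM d\<^esub> y \<in> M" if xM: "x \<in> M" and yM: "y \<in> M" for x y
    proof -
      obtain a where a: "x = vs.lincomb (\<lambda>b. real_of_int (a b)) B"
        using xM unfolding M by blast
      obtain c where c: "y = vs.lincomb (\<lambda>b. real_of_int (c b)) B"
        using yM unfolding M by blast
      have "x + y = vs.lincomb (\<lambda>b. real_of_int (a b + c b)) B"
        by (rule eq_vecI) (use carr[OF xM] carr[OF yM] B a c in
            \<open>auto simp: idx sum.distrib algebra_simps\<close>)
      then show ?thesis
        using mem[of "\<lambda>b. a b + c b"] by (simp add: monoid_vec_simps)
    qed
  qed
qed

lemma Crys_group:
  assumes "crystallographic G d \<rho> M T"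
  shows "group (Crys G d \<rho> T)"
proof -
  interpret G: group G
    using assms by (simp add: crystallographic_def)
  interpret R: comm_group "RM d" by (rule comm_group_vec)
  have lat: "full_lattice d M"
    and \<rho>: "\<And>g. g \<in> carrier G \<Longrightarrow> \<rho> g \<in> carrier_mat d d"
    and \<rho>1: "\<rho> \<one>\<^bsub>G\<^esub> = 1\<^sub>m d"
    and \<rho>m: "\<And>g h. g \<in> carrier G \<Longrightarrow> h \<in> carrier G \<Longrightarrow> \<rho> (g \<otimes>\<^bsub>G\<^esub> h) = \<rho> g * \<rho> h"
    using assms by (auto simp: crystallographic_def ZG_lattice_def)
  have sub: "subgroup M (RM d)"
    using full_lattice_subgroup[OF lat] .
  interpret N: normal M "RM d"
    using R.subgroup_imp_normal[OF sub] .
  interpret Q: group "RM d Mod M"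
    by (rule N.factorgroup_is_group)
  have TQ: "T g \<in> carrier (RM d Mod M)" if "g \<in> carrier G" for g
    using assms that by (auto simp: crystallographic_def cocycle_def)
  have Tm: "T (g \<otimes>\<^bsub>G\<^esub> h) = coset_act \<rho> g (T h) <#>\<^bsub>RM d\<^esub> T g"
    if "g \<in> carrier G" "h \<in> carrier G" for g h
    using assms that by (auto simp: crystallographic_def cocycle_def)
  have Tc: "x \<in> carrier_vec d" if "x \<in> T g" "g \<in> carrier G" for x g
    using TQ[OF that(2)] that(1) N.rcosets_carrier[of "T g"] by (auto simp: FactGroup_def monoid_vec_simps)
  have act1: "coset_act \<rho> \<one>\<^bsub>G\<^esub> (T \<one>\<^bsub>G\<^esub>) = T \<one>\<^bsub>G\<^esub>"
    using Tc by (force simp: coset_act_def \<rho>1)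
  have "T \<one>\<^bsub>G\<^esub> \<otimes>\<^bsub>RM d Mod M\<^esub> T \<one>\<^bsub>G\<^esub> = T \<one>\<^bsub>G\<^esub>"
    using Tm[of "\<one>\<^bsub>G\<^esub>" "\<one>\<^bsub>G\<^esub>"] act1 by simp
  then have T1: "T \<one>\<^bsub>G\<^esub> = M"
    using Q.l_cancel_one[OF TQ TQ] by simp
  have zero: "0\<^sub>v d \<in> T \<one>\<^bsub>G\<^esub>"
    using N.one_closed by (simp add: T1 monoid_vec_simps)
  have mult: "\<rho> g *\<^sub>v y + x \<in> T (g \<otimes>\<^bsub>G\<^esub> h)"
    if "g \<in> carrier G" "h \<in> carrier G" "x \<in> T g" "y \<in> T h" for g h x y
    using that by (auto simp: Tm set_mult_def coset_act_def monoid_vec_simps)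
  show ?thesis
  proof (rule groupI)
    fix a assume "a \<in> carrier (Crys G d \<rho> T)"
    then obtain g x where a: "a = (g, x)" and g: "g \<in> carrier G" and x: "x \<in> T g"
      by (auto simp: Crys_def)
    let ?h = "inv\<^bsub>G\<^esub> g"
    have h: "?h \<in> carrier G" using g by simp
    have "T \<one>\<^bsub>G\<^esub> = coset_act \<rho> ?h (T g) <#>\<^bsub>RM d\<^esub> T ?h"
      using Tm[OF h g] g by simp
    then obtain u y where u: "u \<in> T g" and y: "y \<in> T ?h" and uy: "0\<^sub>v d = \<rho> ?h *\<^sub>v u + y"
      using zero by (auto simp: set_mult_def coset_act_def monoid_vec_simps)
    have xc: "x \<in> carrier_vec d" and uc: "u \<in> carrier_vec d" and yc: "y \<in> carrier_vec d"
      using Tc x u y g h by auto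
    have "\<rho> ?h *\<^sub>v x + y \<in> M"
      using mult[OF h g y x] g T1 by simp
    then have "inv\<^bsub>RM d\<^esub> (\<rho> ?h *\<^sub>v x + y) \<in> M"
      by simp
    moreover have "inv\<^bsub>RM d\<^esub> (\<rho> ?h *\<^sub>v x + y) = - (\<rho> ?h *\<^sub>v x + y)"
      by (rule R.inv_equality) (use xc yc \<rho>[OF h] in \<open>auto simp: monoid_vec_simps\<close>)
    ultimately have m: "- (\<rho> ?h *\<^sub>v x + y) \<in> T \<one>\<^bsub>G\<^esub>"
      by (simp add: T1)
    let ?y = "\<rho> \<one>\<^bsub>G\<^esub> *\<^sub>v y + - (\<rho> ?h *\<^sub>v x + y)"
    have "?y \<in> T (\<one>\<^bsub>G\<^esub> \<otimes>\<^bsub>G\<^esub> ?h)"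
      using mult[OF G.one_closed h m y] .
    then have yT: "?y \<in> T ?h"
      using h by simp
    have hx: "\<rho> ?h *\<^sub>v x \<in> carrier_vec d"
      using \<rho>[OF h] xc by auto
    have "\<rho> ?h *\<^sub>v x + ?y = 0\<^sub>v d"
      by (rule eq_vecI) (use hx yc \<rho>1 in auto)
    then have "(?h, ?y) \<otimes>\<^bsub>Crys G d \<rho> T\<^esub> a = \<one>\<^bsub>Crys G d \<rho> T\<^esub>"
      using g by (simp add: Crys_def a)
    moreover have "(?h, ?y) \<in> carrier (Crys G d \<rho> T)"
      using h yT by (simp add: Crys_def)
    ultimately show "\<exists>b\<in>carrier (Crys G d \<rho> T). b \<otimes>\<^bsub>Crys G d \<rho> T\<^esub> a = \<one>\<^bsub>Crys G d \<rho> T\<^esub>"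
      by blast
  next
    fix a b c
    assume "a \<in> carrier (Crys G d \<rho> T)" "b \<in> carrier (Crys G d \<rho> T)" "c \<in> carrier (Crys G d \<rho> T)"
    then obtain g x h y k z where abc: "a = (g, x)" "b = (h, y)" "c = (k, z)"
      and G: "g \<in> carrier G" "h \<in> carrier G" "k \<in> carrier G"
      and T: "x \<in> T g" "y \<in> T h" "z \<in> T k"
      by (auto simp: Crys_def)
    have V: "x \<in> carrier_vec d" "y \<in> carrier_vec d" "z \<in> carrier_vec d"
      using T G Tc by auto
    have "(\<rho> g * \<rho> h) *\<^sub>v z + (\<rho> g *\<^sub>v y + x) = \<rho> g *\<^sub>v (\<rho> h *\<^sub>v z + y) + x"
      using V \<rho>[OF G(1)] \<rho>[OF G(2)]
      by (simp add: mult_add_distrib_mat_vec[of _ d d] assoc_mult_mat_vec[of _ d d _ d]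
          assoc_add_vec[of _ d])
    then show "(a \<otimes>\<^bsub>Crys G d \<rho> T\<^esub> b) \<otimes>\<^bsub>Crys G d \<rho> T\<^esub> c =
        a \<otimes>\<^bsub>Crys G d \<rho> T\<^esub> (b \<otimes>\<^bsub>Crys G d \<rho> T\<^esub> c)"
      using G by (simp add: Crys_def abc \<rho>m G.m_assoc)
  qed (use zero mult Tc in \<open>auto simp: Crys_def \<rho>1\<close>)
qed

end

theory Submission
  imports "HOL-Algebra.Multiplicative_Group" Defs
begin

text \<open>
  Let \<open>N\<close> be the order of the group, \<open>p\<close> the prime with \<open>p\<^sup>3 | N\<close>, and put \<open>t = x - 1\<close>, \<open>f = x\<^sup>p - 1\<close>,
  \<open>h = (x\<^sup>N - 1) / f\<close> in \<open>\<int>[x]\<close>.  A module over the group ring is a \<open>\<int>[x]\<close>-module killed by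
  \<open>x\<^sup>N - 1\<close>, where \<open>x\<close> acts as a fixed generator.  The lattice \<open>M\<close> has generators \<open>a\<^sub>i\<close>, \<open>b\<^sub>i\<close> (\<open>i < m\<close>)
  and relations \<open>f a\<^sub>i = t b\<^sub>i + p b\<^sub>i\<^sub>+\<^sub>1\<close> (with \<open>b\<^sub>m = 0\<close>) and \<open>h b\<^sub>i = 0\<close>.  It is the extension of
  \<open>(\<int>[x]/f)\<^sup>m\<close> by \<open>(\<int>[x]/h)\<^sup>m\<close> whose class is the matrix \<open>t I + p J\<close> over \<open>\<int>[x]/(f, h)\<close>, where \<open>J\<close> is
  a nilpotent Jordan block of size \<open>m\<close>; its rank is \<open>m deg f + m deg h = m N\<close>.

  \<open>M\<close> is indecomposable.  An idempotent endomorphism of \<open>M\<close> induces idempotent matrices \<open>W\<close> over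
  \<open>\<int>[x]/h\<close> and \<open>U\<close> over \<open>\<int>[x]/f\<close> with \<open>(t I + p J) U = W (t I + p J)\<close> over \<open>\<int>[x]/(f, h)\<close>.  As
  \<open>p\<^sup>3 | N\<close>, both \<open>f\<close> and \<open>h\<close> lie in the square of the maximal ideal \<open>(p, t)\<close>, so \<open>t\<close> and \<open>p\<close> stay
  linearly independent modulo that square.  Comparing coefficients, \<open>U\<close> and \<open>W\<close> agree modulo \<open>(p, t)\<close>
  and commute with \<open>J\<close> there (\<open>glue_defect_local\<close>): they are lower triangular with constant
  diagonals (\<open>glue_toeplitz\<close>).  The diagonal entry is \<open>0\<close> or \<open>1\<close>; after passing to the complementary
  idempotent it is \<open>0\<close>, and a nilpotent idempotent vanishes.  That a projection which vanishes modulo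
  \<open>(p, t)\<close> is zero follows by moving through the cyclotomic factors of \<open>x\<^sup>N - 1\<close> one prime at a time:
  two polynomials that have the same radical modulo a prime \<open>q\<close> cannot be separated by an idempotent
  (\<open>idem_mod_contract\<close>, \<open>idem_mod_augmentation_zero_geo\<close>).

  The cocycle.  The vector \<open>w = (f / t) a\<^sub>m\<^sub>-\<^sub>1 - b\<^sub>m\<^sub>-\<^sub>1\<close> is fixed by \<open>x\<close>, since
  \<open>t w = f a\<^sub>m\<^sub>-\<^sub>1 - t b\<^sub>m\<^sub>-\<^sub>1 = 0\<close>.  Hence \<open>x\<^sup>k \<mapsto> (k / N) w + M\<close> is a cocycle.  If \<open>p | k\<close> then \<open>x\<^sup>k\<close> acts
  trivially on \<open>\<int>[x]/f\<close>, so the constant coefficient at \<open>a\<^sub>m\<^sub>-\<^sub>1\<close> is an invariant linear form, equal to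
  \<open>1\<close> on \<open>w\<close>; on the coset belonging to \<open>x\<^sup>k\<close> it takes values in \<open>k / N + \<int>\<close>.  A torsion element over
  \<open>x\<^sup>k\<close>, with \<open>p | k\<close>, must give the value \<open>0\<close>, hence \<open>N | k\<close>.  Any element over \<open>x\<^sup>k \<noteq> 1\<close> has a power
  over some \<open>x\<^sup>i\<close> of prime order, and \<open>p\<^sup>2 | N\<close> forces \<open>p | i\<close>, so the group is torsionfree.  The same form
  shows that the cocycle is not a coboundary.
\<close>

section \<open>Division by monic integer polynomials\<close>

definition quo :: "int poly \<Rightarrow> int poly \<Rightarrow> int poly" where
  "quo g u = fst (pseudo_divmod u g)"

definition remd :: "int poly \<Rightarrow> int poly \<Rightarrow> int poly" where
  "remd g u = u - g * quo g u"

definition monic_nonconst :: "int poly \<Rightarrow> bool" where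
  "monic_nonconst g \<longleftrightarrow> lead_coeff g = 1 \<and> degree g > 0"

lemma quo_remd: "g * quo g u + remd g u = u"
  by (simp add: remd_def)

lemma degree_remd:
  assumes "monic_nonconst g"
  shows "degree (remd g u) < degree g"
proof -
  have g: "g \<noteq> 0" using assms by (auto simp: monic_nonconst_def)
  obtain q r where qr: "pseudo_divmod u g = (q, r)" by force
  from pseudo_divmod[OF g qr] assms have "u = g * q + r" and "r = 0 \<or> degree r < degree g"
    by (auto simp: monic_nonconst_def)
  then have "remd g u = r" using qr by (simp add: remd_def quo_def)
  with \<open>r = 0 \<or> degree r < degree g\<close> show ?thesis
    using assms by (auto simp: monic_nonconst_def)
qed

lemma quo_remd_unique:
  assumes g: "monic_nonconst g" and u: "u = g * q + r" and r: "degree r < degree g"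
  shows "quo g u = q" "remd g u = r"
proof -
  have g0: "g \<noteq> 0" using g by (auto simp: monic_nonconst_def)
  have eq: "g * (quo g u - q) = r - remd g u"
    using quo_remd[of g u] u by (simp add: algebra_simps)
  have deg: "degree (r - remd g u) < degree g"
    using r degree_remd[OF g, of u] by (rule degree_diff_less)
  have "quo g u - q = 0"
  proof (rule ccontr)
    assume "quo g u - q \<noteq> 0"
    then have "degree (g * (quo g u - q)) \<ge> degree g"
      using g0 by (simp add: degree_mult_eq)
    with eq deg show False by simp
  qed
  then show "quo g u = q" by simp
  then show "remd g u = r" using quo_remd[of g u] u by simp
qed

lemma quo_add: "monic_nonconst g \<Longrightarrow> quo g (u + v) = quo g u + quo g v"
  and remd_add: "monic_nonconst g \<Longrightarrow> remd g (u + v) = remd g u + remd g v"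
proof -
  assume g: "monic_nonconst g"
  have "u + v = g * (quo g u + quo g v) + (remd g u + remd g v)"
    using quo_remd[of g u] quo_remd[of g v] by (simp add: algebra_simps)
  from quo_remd_unique[OF g this degree_add_less[OF degree_remd[OF g] degree_remd[OF g]]]
  show "quo g (u + v) = quo g u + quo g v" "remd g (u + v) = remd g u + remd g v" .
qed

lemma quo_smult: "monic_nonconst g \<Longrightarrow> quo g (Polynomial.smult c u) = Polynomial.smult c (quo g u)"
  and remd_smult: "monic_nonconst g \<Longrightarrow> remd g (Polynomial.smult c u) = Polynomial.smult c (remd g u)"
proof -
  assume g: "monic_nonconst g"
  have "Polynomial.smult c (g * quo g u + remd g u) = g * Polynomial.smult c (quo g u) + Polynomial.smult c (remd g u)"
    by (simp add: smult_add_right)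
  then have "Polynomial.smult c u = g * Polynomial.smult c (quo g u) + Polynomial.smult c (remd g u)"
    by (simp add: quo_remd)
  moreover have "degree (Polynomial.smult c (remd g u)) < degree g"
    using degree_remd[OF g, of u] degree_smult_le le_less_trans by blast
  ultimately show "quo g (Polynomial.smult c u) = Polynomial.smult c (quo g u)" "remd g (Polynomial.smult c u) = Polynomial.smult c (remd g u)"
    using quo_remd_unique[OF g] by blast+
qed

lemma quo_mult: "monic_nonconst g \<Longrightarrow> quo g (g * c) = c"
  and remd_mult: "monic_nonconst g \<Longrightarrow> remd g (g * c) = 0"
  using quo_remd_unique[of g "g * c" c 0] by (auto simp: monic_nonconst_def)

lemma quo_small: "monic_nonconst g \<Longrightarrow> degree u < degree g \<Longrightarrow> quo g u = 0"
  and remd_small: "monic_nonconst g \<Longrightarrow> degree u < degree g \<Longrightarrow> remd g u = u"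
  using quo_remd_unique[of g u 0 u] by auto

lemma remd_eq_0_iff: "monic_nonconst g \<Longrightarrow> remd g u = 0 \<longleftrightarrow> g dvd u"
  by (metis add.right_neutral dvd_def quo_remd remd_mult)

text \<open>
  The remainder is determined by its coefficients below the degree of the divisor, which later serve
  as the lattice coordinates.
\<close>

lemma remd_0_coeff_iff:
  assumes g: "monic_nonconst g"
  shows "(\<forall>j<degree g. coeff (remd g u) j = 0) \<longleftrightarrow> g dvd u"
proof -
  have "(\<forall>j<degree g. coeff (remd g u) j = 0) \<longleftrightarrow> remd g u = 0"
    using degree_remd[OF g, of u] by (metis coeff_0 leading_coeff_0_iff)
  then show ?thesis using remd_eq_0_iff[OF g] by simp
qed

lemma monic_dvd_of_dvd_smult:
  assumes g: "monic_nonconst g" and c: "c \<noteq> 0" and "g dvd Polynomial.smult c u"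
  shows "g dvd u"
proof -
  have "Polynomial.smult c (remd g u) = 0"
    using assms remd_smult[OF g] remd_eq_0_iff[OF g] by metis
  then show ?thesis using c remd_eq_0_iff[OF g] by simp
qed

text \<open>
  The quotient of \<open>\<int>[x]\<close> by a monic polynomial is a free abelian group, so its only element that is
  divisible by all powers of \<open>q\<close> is zero.
\<close>

lemma dvd_of_approx:
  assumes g: "monic_nonconst g" and q: "q > 1"
    and approx: "\<And>i::nat. \<exists>r s. u = g * r + Polynomial.smult (int q ^ i) s"
  shows "g dvd u"
proof -
  have "coeff (remd g u) j = 0" for j
  proof (rule ccontr)
    let ?c = "coeff (remd g u) j"
    assume nz: "?c \<noteq> 0"
    obtain r s where "u = g * r + Polynomial.smult (int q ^ nat \<bar>?c\<bar>) s" using approx by blast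
    then have "remd g u = Polynomial.smult (int q ^ nat \<bar>?c\<bar>) (remd g s)"
      by (metis add_0 g remd_add remd_mult remd_smult)
    then have "int q ^ nat \<bar>?c\<bar> dvd ?c"
      by (metis coeff_smult dvd_triv_left)
    then have "int q ^ nat \<bar>?c\<bar> \<le> \<bar>?c\<bar>"
      using dvd_imp_le_int[OF nz] by fastforce
    moreover have "\<bar>?c\<bar> < int q ^ nat \<bar>?c\<bar>"
    proof -
      have "nat \<bar>?c\<bar> < q ^ nat \<bar>?c\<bar>" using q by (simp add: power_gt_expt)
      then have "int (nat \<bar>?c\<bar>) < int (q ^ nat \<bar>?c\<bar>)" by (simp only: of_nat_less_iff)
      then show ?thesis by simp
    qed
    ultimately show False by simp
  qed
  then have "remd g u = 0" by (simp add: poly_eq_iff)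
  then show ?thesis using remd_eq_0_iff[OF g] by simp
qed

section \<open>Powers modulo a prime\<close>

lemma freshman_add:
  fixes A B :: "'a::comm_ring_1"
  assumes q: "prime q"
  shows "\<exists>R. (A + B) ^ q = A ^ q + B ^ q + of_nat q * R"
proof -
  have q1: "q > 1" using q prime_gt_1_nat by blast
  have "of_nat q dvd (of_nat (q choose k) :: 'a)" if "0 < k" "k < q" for k
  proof -
    have "q dvd q choose k"
      using that q by (intro dvd_choose_prime) auto
    then show ?thesis by (auto simp: dvd_def)
  qed
  then have "of_nat q dvd (\<Sum>k\<in>{1..<q}. of_nat (q choose k) * A ^ k * B ^ (q - k))"
    by (intro dvd_sum) (auto intro!: dvd_mult2)
  then obtain R where R: "(\<Sum>k\<in>{1..<q}. of_nat (q choose k) * A ^ k * B ^ (q - k)) = of_nat q * R"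
    by (elim dvdE)
  have split: "{..q} = insert 0 (insert q {1..<q})" using q1 by auto
  have "(A + B) ^ q = B ^ q + (A ^ q + of_nat q * R)"
    unfolding binomial_ring split using q1 by (simp add: R[simplified])
  then show ?thesis by (intro exI[of _ R]) (simp add: algebra_simps)
qed

lemma freshman_sum:
  fixes A :: "'i \<Rightarrow> 'a::comm_ring_1"
  assumes q: "prime q" and "finite I"
  shows "\<exists>R. (\<Sum>i\<in>I. A i) ^ q = (\<Sum>i\<in>I. A i ^ q) + of_nat q * R"
  using \<open>finite I\<close>
proof induction
  case empty
  show ?case using prime_gt_0_nat[OF q] by (intro exI[of _ 0]) (simp add: power_0_left)
next
  case (insert x F)
  then obtain R where R: "(\<Sum>i\<in>F. A i) ^ q = (\<Sum>i\<in>F. A i ^ q) + of_nat q * R" by blast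
  obtain R' where R': "(A x + (\<Sum>i\<in>F. A i)) ^ q = A x ^ q + (\<Sum>i\<in>F. A i) ^ q + of_nat q * R'"
    using freshman_add[OF q] by blast
  show ?case using insert R R' by (intro exI[of _ "R + R'"]) (simp add: algebra_simps)
qed

lemma freshman_minus_one:
  fixes z :: "'a::comm_ring_1"
  assumes q: "prime q"
  shows "\<exists>R. (z - 1) ^ (q ^ k) = z ^ (q ^ k) - 1 + of_nat q * R"
proof (induction k)
  case 0
  show ?case by (intro exI[of _ 0]) simp
next
  case (Suc k)
  then obtain R where R: "(z - 1) ^ (q ^ k) = (z ^ (q ^ k) - 1) + of_nat q * R" by blast
  let ?y = "z ^ (q ^ k)"
  obtain R1 where R1: "(?y - 1 + of_nat q * R) ^ q = (?y - 1) ^ q + (of_nat q * R) ^ q + of_nat q * R1"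
    using freshman_add[OF q] by blast
  obtain R2 where R2: "((?y - 1) + 1) ^ q = (?y - 1) ^ q + 1 ^ q + of_nat q * R2"
    using freshman_add[OF q] by blast
  have "of_nat q dvd (of_nat q * R) ^ q"
    using prime_gt_0_nat[OF q] by (intro dvd_trans[OF _ dvd_power]) auto
  then obtain R3 where R3: "(of_nat q * R) ^ q = of_nat q * R3" by (elim dvdE)
  have "(z - 1) ^ (q ^ Suc k) = (?y - 1 + of_nat q * R) ^ q"
    by (simp only: R power_Suc2 power_mult)
  also have "\<dots> = ?y ^ q - 1 + of_nat q * (R1 - R2 + R3)"
    using R1 R2 R3 by (simp add: algebra_simps)
  also have "?y ^ q = z ^ (q ^ Suc k)"
    by (simp only: power_Suc2 power_mult)
  finally show ?case by blast
qed

section \<open>Geometric sums of monomials\<close>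

abbreviation xm1 :: "nat \<Rightarrow> int poly" where
  "xm1 a \<equiv> Polynomial.monom 1 a - 1"

definition geo :: "nat \<Rightarrow> nat \<Rightarrow> int poly" where
  "geo a n = (\<Sum>j<n. Polynomial.monom 1 (a * j))"

lemma monom_eq_power: "Polynomial.monom (1::int) (a * j) = Polynomial.monom 1 a ^ j"
  by (simp add: monom_power)

lemma geo_mult: "xm1 a * geo a n = xm1 (a * n)"
  unfolding geo_def monom_eq_power by (rule power_diff_1_eq[symmetric])

lemma monic_xm1: "a > 0 \<Longrightarrow> monic_nonconst (xm1 a)"
  and degree_xm1: "a > 0 \<Longrightarrow> degree (xm1 a) = a"
proof -
  assume a: "a > 0"
  have d: "degree (xm1 a) = a"
    using a by (intro antisym le_degree degree_diff_le) (auto simp: degree_monom_eq)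
  then show "degree (xm1 a) = a" .
  show "monic_nonconst (xm1 a)" using a by (simp add: monic_nonconst_def d)
qed

lemma monic_geo:
  assumes "a > 0" "n > 1"
  shows "monic_nonconst (geo a n)" "degree (geo a n) = a * n - a"
proof -
  have an: "a * n > a" using assms by simp
  have x: "monic_nonconst (xm1 a)" "monic_nonconst (xm1 (a * n))"
    using assms an by (auto intro!: monic_xm1)
  have "lead_coeff (xm1 a) * lead_coeff (geo a n) = lead_coeff (xm1 (a * n))"
    by (metis geo_mult lead_coeff_mult)
  then have l: "lead_coeff (geo a n) = 1"
    using x unfolding monic_nonconst_def by (metis mult_1)
  then have nz: "geo a n \<noteq> 0" by auto
  have xz: "xm1 a \<noteq> 0" using x by (auto simp: monic_nonconst_def)
  have "degree (xm1 a * geo a n) = degree (xm1 a) + degree (geo a n)"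
    using xz nz by (rule degree_mult_eq)
  then show d: "degree (geo a n) = a * n - a"
    unfolding geo_mult using assms by (simp add: degree_xm1)
  show "monic_nonconst (geo a n)" using l d an by (simp add: monic_nonconst_def)
qed

lemma poly_geo_1: "poly (geo a n) 1 = int n"
  by (simp add: geo_def poly_sum poly_monom)

lemma pderiv_geo_1: "int a dvd poly (pderiv (geo a n)) 1"
proof -
  have "pderiv (geo a n) = (\<Sum>j<n. pderiv (Polynomial.monom 1 (a * j)))"
    unfolding geo_def by (induction n) (simp_all add: pderiv_add)
  then have "poly (pderiv (geo a n)) 1 = (\<Sum>j<n. int (a * j))"
    by (simp add: poly_sum pderiv_monom poly_monom)
  also have "int a dvd \<dots>" by (intro dvd_sum) simp
  finally show ?thesis .
qed

section \<open>Idempotent matrices over quotients of the integer polynomials\<close>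

definition ideal3 :: "int poly \<Rightarrow> int poly \<Rightarrow> int poly \<Rightarrow> int poly set" where
  "ideal3 A B C = {A * a + B * b + C * c | a b c. True}"

lemma ideal3I: "u = A * a + B * b + C * c \<Longrightarrow> u \<in> ideal3 A B C"
  by (auto simp: ideal3_def)

lemma ideal3_add: "u \<in> ideal3 A B C \<Longrightarrow> v \<in> ideal3 A B C \<Longrightarrow> u + v \<in> ideal3 A B C"
proof -
  assume "u \<in> ideal3 A B C" "v \<in> ideal3 A B C"
  then obtain a b c a' b' c' where "u = A * a + B * b + C * c" "v = A * a' + B * b' + C * c'"
    by (auto simp: ideal3_def)
  then show ?thesis
    by (intro ideal3I[of _ A "a + a'" B "b + b'" C "c + c'"]) (simp add: algebra_simps)
qed

lemma ideal3_sum: "(\<And>i. i \<in> I \<Longrightarrow> u i \<in> ideal3 A B C) \<Longrightarrow> (\<Sum>i\<in>I. u i) \<in> ideal3 A B C"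
proof (induction I rule: infinite_finite_induct)
  case (insert x F)
  then show ?case by (auto intro: ideal3_add)
qed (auto intro: ideal3I[of _ _ 0 _ 0 _ 0])

text \<open>
  Divisibility stands for equality over the quotient ring, so matrices are kept over \<open>\<int>[x]\<close> itself.
\<close>

definition idem_mod :: "nat \<Rightarrow> int poly \<Rightarrow> (nat \<Rightarrow> nat \<Rightarrow> int poly) \<Rightarrow> bool" where
  "idem_mod m h W \<longleftrightarrow> (\<forall>i<m. \<forall>j<m. h dvd (\<Sum>k<m. W i k * W k j) - W i j)"

text \<open>
  The matrix equals its square modulo \<open>h\<close>, so its entries lie, up to multiples of \<open>h\<close>, in the product of
  any two ideals that contain them.
\<close>

lemma idem_mod_ideal3:
  assumes W: "idem_mod m h W" and Q: "Q dvd h"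
    and I: "\<And>i j. i < m \<Longrightarrow> j < m \<Longrightarrow> W i j \<in> I" and I': "\<And>i j. i < m \<Longrightarrow> j < m \<Longrightarrow> W i j \<in> I'"
    and prod: "\<And>u v. u \<in> I \<Longrightarrow> v \<in> I' \<Longrightarrow> u * v \<in> ideal3 A B Q"
    and ij: "i < m" "j < m"
  shows "W i j \<in> ideal3 A B Q"
proof -
  have "(\<Sum>k<m. W i k * W k j) \<in> ideal3 A B Q"
    using ij by (intro ideal3_sum prod I I') auto
  moreover obtain c where "(\<Sum>k<m. W i k * W k j) - W i j = Q * c"
    using W Q ij unfolding idem_mod_def by (meson dvdE dvd_trans)
  then have "W i j = (\<Sum>k<m. W i k * W k j) + Q * (- c)"
    by (simp add: algebra_simps)
  moreover have "Q * (- c) \<in> ideal3 A B Q"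
    by (intro ideal3I[of _ _ 0 _ 0 _ "- c"]) simp
  ultimately show ?thesis using ideal3_add by metis
qed

text \<open>
  The tool that spreads the vanishing of an idempotent.  As the matrix equals its powers modulo \<open>h\<close>, its
  entries lie in \<open>(Q1\<^sup>k, q, Q)\<close> for every \<open>k\<close>; for \<open>k = e\<close> this ideal is contained in \<open>(q, Q)\<close>.  Taking
  powers once more, the entries lie in \<open>(q\<^sup>k, Q)\<close> for every \<open>k\<close>.  The intersection of these ideals is \<open>(Q)\<close>.
\<close>

lemma idem_mod_contract:
  assumes W: "idem_mod m h W" and Q: "monic_nonconst Q" "Q dvd h" and q: "q > 1"
    and ent: "\<And>i j. i < m \<Longrightarrow> j < m \<Longrightarrow> W i j \<in> ideal3 Q1 (of_nat q) Q"
    and pow: "Q1 ^ e = Q * c + of_nat q * d"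
    and ij: "i < m" "j < m"
  shows "Q dvd W i j"
proof -
  have 1: "\<forall>i<m. \<forall>j<m. W i j \<in> ideal3 (Q1 ^ k) (of_nat q) Q" for k
  proof (induction k)
    case 0
    show ?case by (auto intro: ideal3I[of _ _ "W i j" for i j, where b = 0 and c = 0])
  next
    case (Suc k)
    have "u * v \<in> ideal3 (Q1 ^ Suc k) (of_nat q) Q"
      if "u \<in> ideal3 (Q1 ^ k) (of_nat q) Q" "v \<in> ideal3 Q1 (of_nat q) Q" for u v
    proof -
      obtain a b c a' b' c' where uv: "u = Q1 ^ k * a + of_nat q * b + Q * c"
        "v = Q1 * a' + of_nat q * b' + Q * c'"
        using \<open>u \<in> _\<close> \<open>v \<in> _\<close> unfolding ideal3_def by blast
      have "u * v = Q1 ^ Suc k * (a * a') + of_nat q * (Q1 ^ k * a * b' + b * v)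
          + Q * (Q1 ^ k * a * c' + c * v)"
        unfolding uv by (simp add: algebra_simps)
      then show ?thesis by (rule ideal3I)
    qed
    then show ?case using idem_mod_ideal3[OF W Q(2) _ ent] Suc.IH by blast
  qed
  have q1: "W i j \<in> ideal3 0 (of_nat q) Q" if ij: "i < m" "j < m" for i j
  proof -
    obtain a b c' where "W i j = Q1 ^ e * a + of_nat q * b + Q * c'"
      using 1[of e] ij unfolding ideal3_def by blast
    then have "W i j = 0 * 0 + of_nat q * (d * a + b) + Q * (c * a + c')"
      unfolding pow by (simp add: algebra_simps)
    then show ?thesis by (rule ideal3I)
  qed
  have 2: "\<forall>i<m. \<forall>j<m. W i j \<in> ideal3 0 (of_nat q ^ k) Q" for k
  proof (induction k)
    case 0
    show ?case by (auto intro: ideal3I[where a = 0 and b = "W i j" for i j, where c = 0])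
  next
    case (Suc k)
    have "u * v \<in> ideal3 0 (of_nat q ^ Suc k) Q"
      if "u \<in> ideal3 0 (of_nat q ^ k) Q" "v \<in> ideal3 0 (of_nat q) Q" for u v
    proof -
      obtain b c b' c' where uv: "u = of_nat q ^ k * b + Q * c" "v = of_nat q * b' + Q * c'"
        using \<open>u \<in> _\<close> \<open>v \<in> _\<close> unfolding ideal3_def by auto
      have "u * v = 0 * 0 + of_nat q ^ Suc k * (b * b') + Q * (of_nat q ^ k * b * c' + c * v)"
        unfolding uv by (simp add: algebra_simps)
      then show ?thesis by (rule ideal3I)
    qed
    then show ?case using idem_mod_ideal3[OF W Q(2) _ q1] Suc.IH by blast
  qed
  show ?thesis
  proof (rule dvd_of_approx[OF Q(1) q])
    fix k
    have "W i j \<in> ideal3 0 (of_nat q ^ k) Q" using 2 ij by blast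
    then obtain b c where "W i j = of_nat q ^ k * b + Q * c"
      unfolding ideal3_def by auto
    moreover have pw: "(of_nat q :: int poly) ^ k = [:int q ^ k:]"
      by (metis of_nat_poly of_nat_power)
    ultimately have "W i j = Q * c + Polynomial.smult (int q ^ k) b"
      using pw by simp
    then show "\<exists>r s. W i j = Q * r + Polynomial.smult (int q ^ k) s" by blast
  qed
qed

text \<open>
  The kernel of evaluation at \<open>1\<close> modulo \<open>p\<close> is the ideal \<open>(x - 1, p)\<close>.
\<close>

lemma in_augmentation:
  assumes "int p dvd poly u 1"
  shows "u \<in> ideal3 (xm1 1) (of_nat p) Q"
proof -
  obtain c where c: "poly u 1 = int p * c" using assms by (elim dvdE)
  have "poly (u - [:poly u 1:]) 1 = 0" by simp
  then have "[:-1, 1:] dvd u - [:poly u 1:]" by (metis add.inverse_inverse poly_eq_0_iff_dvd)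
  moreover have "[:-1, 1:] = xm1 1" by (simp add: monom_altdef one_pCons)
  ultimately obtain a where "u - [:poly u 1:] = xm1 1 * a" by (auto elim: dvdE)
  then have "u = xm1 1 * a + of_nat p * [:c:] + Q * 0"
    by (simp add: c of_nat_poly algebra_simps)
  then show ?thesis by (rule ideal3I)
qed

text \<open>
  The ring \<open>\<int>[x]/(x\<^sup>p - 1)\<close> is local modulo \<open>p\<close>, because \<open>(x - 1)\<^sup>p\<close> is congruent to \<open>x\<^sup>p - 1\<close>.
\<close>

lemma idem_mod_augmentation_zero_xm1:
  assumes p: "prime p" and U: "idem_mod m (xm1 p) U"
    and 1: "\<And>i j. i < m \<Longrightarrow> j < m \<Longrightarrow> int p dvd poly (U i j) 1"
    and ij: "i < m" "j < m"
  shows "xm1 p dvd U i j"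
proof -
  obtain R where R: "(Polynomial.monom (1::int) 1 - 1) ^ (p ^ 1) = Polynomial.monom 1 1 ^ (p ^ 1) - 1 + of_nat p * R"
    using freshman_minus_one[OF p] by blast
  then have R: "xm1 1 ^ p = xm1 p * 1 + of_nat p * R"
    by (simp add: monom_power)
  show ?thesis
    using idem_mod_contract[OF U _ dvd_refl prime_gt_1_nat[OF p] in_augmentation[OF 1] R ij]
      monic_xm1 prime_gt_0_nat[OF p] by blast
qed

lemma xm1_dvd: "xm1 a dvd xm1 (a * n)"
  by (metis dvd_triv_left geo_mult)

text \<open>
  Write \<open>S\<^sub>k\<close> for \<open>(x^(k p\<^sup>3) - 1) / (x^(k p) - 1)\<close>.  The vanishing spreads along three kinds of
  congruences: a power of \<open>x - 1\<close> lies in \<open>(p, S\<^sub>1)\<close>; modulo a prime \<open>q\<close> the \<open>q\<close>-th power of \<open>S\<^sub>l\<close> is \<open>S\<^sub>k\<close> for \<open>k = l q\<close>, which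
  reaches \<open>S\<^sub>k\<close> for all \<open>k | N'\<close>; and finally the square of \<open>S\<^sub>k\<close> for \<open>k = N'\<close> lies in the ideal generated by \<open>p\<close> and
  the given geometric sum, which brings in the factors of that sum that do not divide \<open>S\<^sub>k\<close>.
\<close>

lemma idem_mod_augmentation_zero_geo:
  assumes p: "prime p" and N': "N' > 0" and W: "idem_mod m (geo p (p\<^sup>2 * N')) W"
    and 1: "\<And>i j. i < m \<Longrightarrow> j < m \<Longrightarrow> int p dvd poly (W i j) 1"
    and ij: "i < m" "j < m"
  shows "geo p (p\<^sup>2 * N') dvd W i j"
proof -
  let ?h = "geo p (p\<^sup>2 * N')"
  let ?S = "\<lambda>k. geo (k * p) (p\<^sup>2)"
  have p1: "p > 1" using p prime_gt_1_nat by blast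
  then have p2: "p\<^sup>2 > 1" using one_less_power[of p 2] by simp
  moreover have "p\<^sup>2 \<le> p\<^sup>2 * N'" using N' by simp
  ultimately have p2': "p\<^sup>2 * N' > 1" by (rule less_le_trans)
  have xp: "xm1 p \<noteq> 0" using monic_xm1[of p] p1 by (auto simp: monic_nonconst_def)
  have hx: "xm1 p * ?h = xm1 (p ^ 3 * N')"
    by (simp add: geo_mult power2_eq_square power3_eq_cube mult.assoc)
  have Sx: "xm1 (k * p) * ?S k = xm1 (k * p ^ 3)" for k
    by (simp add: geo_mult power2_eq_square power3_eq_cube mult.assoc)
  have Sh: "?S k dvd ?h" if "k dvd N'" for k
  proof -
    from that obtain l where l: "N' = k * l" by (elim dvdE)
    have "xm1 p * ?S k dvd xm1 (k * p) * ?S k"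
      using xm1_dvd[of p k] by (simp add: mult.commute mult_dvd_mono)
    also have "\<dots> dvd xm1 (p ^ 3 * N')"
      unfolding Sx l using xm1_dvd[of "k * p ^ 3" l] by (simp add: ac_simps)
    finally show ?thesis using xp by (simp flip: hx)
  qed
  have Sm: "monic_nonconst (?S k)" if "k > 0" for k
    using monic_geo(1)[of "k * p" "p\<^sup>2"] that p1 p2 by simp
  have S: "\<forall>i<m. \<forall>j<m. ?S k dvd W i j" if "k dvd N'" for k
    using that
  proof (induction k rule: less_induct)
    case (less k)
    have k0: "k > 0" using less.prems N' by (auto intro: Nat.gr0I)
    show ?case
    proof (cases "k = 1")
      case True
      obtain R where "(Polynomial.monom (1::int) 1 - 1) ^ (p ^ 3) = Polynomial.monom 1 1 ^ (p ^ 3) - 1 + of_nat p * R"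
        using freshman_minus_one[OF p] by blast
      then have R: "xm1 1 ^ (p ^ 3) = ?S k * xm1 p + of_nat p * R"
        using Sx[of 1] by (simp add: monom_power True mult.commute)
      show ?thesis
        using idem_mod_contract[OF W Sm[OF k0] Sh[OF less.prems] p1 in_augmentation[OF 1] R] by blast
    next
      case False
      then obtain q where q: "prime q" "q dvd k" using prime_factor_nat by blast
      then obtain l where l: "k = l * q" by (metis dvdE mult.commute)
      have "l < k" using l k0 prime_gt_1_nat[OF q(1)] by (cases "l = 0") auto
      moreover have "l dvd N'" using l less.prems by (metis dvd_mult_left)
      ultimately have IH: "\<forall>i<m. \<forall>j<m. ?S l dvd W i j" using less.IH by blast
      obtain R where "?S l ^ q = (\<Sum>j<p\<^sup>2. Polynomial.monom 1 (l * p * j) ^ q) + of_nat q * R"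
        unfolding geo_def using freshman_sum[OF q(1)] by blast
      then have R: "?S l ^ q = ?S k * 1 + of_nat q * R"
        by (simp add: geo_def monom_power l ac_simps)
      have "W i j \<in> ideal3 (?S l) (of_nat q) (?S k)" if ij: "i < m" "j < m" for i j
      proof -
        obtain c where "W i j = ?S l * c" using IH ij by (meson dvdE)
        then show ?thesis by (intro ideal3I[where a = c and b = 0 and c = 0]) simp
      qed
      then show ?thesis
        using idem_mod_contract[OF W Sm[OF k0] Sh[OF less.prems] prime_gt_1_nat[OF q(1)] _ R] by blast
    qed
  qed
  have ent: "W i j \<in> ideal3 (?S N') (of_nat p) ?h" if ij: "i < m" "j < m" for i j
  proof -
    obtain c where "W i j = ?S N' * c" using S[OF dvd_refl] ij by (meson dvdE)
    then show ?thesis by (intro ideal3I[where a = c and b = 0 and c = 0]) simp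
  qed
  \<comment> \<open>With \<open>y = x^(N' p)\<close>, the sum \<open>S\<close> of the \<open>y\<^sup>j\<close> is \<open>p\<^sup>2\<close> modulo \<open>y - 1\<close>, while \<open>(y - 1) S\<close> is a multiple of \<open>h\<close>.\<close>
  have "xm1 (N' * p) dvd (\<Sum>j<p\<^sup>2. xm1 (N' * p * j))"
    by (intro dvd_sum xm1_dvd)
  then obtain R where R: "(\<Sum>j<p\<^sup>2. xm1 (N' * p * j)) = xm1 (N' * p) * R" by (elim dvdE)
  then have R: "?S N' = xm1 (N' * p) * R + of_nat (p\<^sup>2)"
    by (simp add: geo_def sum_subtractf algebra_simps)
  have "?S N' ^ 2 = ?S N' * (xm1 (N' * p) * R + of_nat (p\<^sup>2))"
    using R by (simp add: power2_eq_square)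
  also have "\<dots> = (xm1 (N' * p) * ?S N') * R + of_nat p * (of_nat p * ?S N')"
    by (simp add: algebra_simps power2_eq_square)
  also have "xm1 (N' * p) * ?S N' = ?h * xm1 p"
    unfolding Sx using hx by (simp add: ac_simps)
  finally have pow: "?S N' ^ 2 = ?h * (xm1 p * R) + of_nat p * (of_nat p * ?S N')"
    by (simp add: ac_simps)
  show ?thesis
    using idem_mod_contract[OF W monic_geo(1) dvd_refl p1 ent pow ij] p1 p2' by simp
qed

section \<open>Idempotents compatible with the gluing matrix\<close>

text \<open>
  A strictly triangular idempotent is nilpotent, hence zero: squaring moves the nonzero entries
  further away from the diagonal.
\<close>

lemma idempotent_lower_triangular_mod:
  fixes w :: "nat \<Rightarrow> nat \<Rightarrow> int"
  assumes idem: "\<And>i j. i < m \<Longrightarrow> j < m \<Longrightarrow> c dvd (\<Sum>k<m. w i k * w k j) - w i j"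
    and tri: "\<And>i j. i \<le> j \<Longrightarrow> j < m \<Longrightarrow> c dvd w i j"
    and ij: "i < m" "j < m"
  shows "c dvd w i j"
proof -
  have "\<forall>i<m. \<forall>j<m. i \<le> j + d \<longrightarrow> c dvd w i j" for d
  proof (induction d)
    case 0
    then show ?case using tri by simp
  next
    case (Suc d)
    have "c dvd w i j" if ij: "i < m" "j < m" "i \<le> j + Suc d" for i j
    proof -
      have "c dvd w i k * w k j" if "k < m" for k
      proof (cases "k \<le> j")
        case True
        then show ?thesis using tri[of k j] ij by simp
      next
        case False
        then have "i \<le> k + d" using ij by simp
        then show ?thesis using Suc.IH ij that by simp
      qed
      then have "c dvd (\<Sum>k<m. w i k * w k j)" by (intro dvd_sum) auto
      with idem[OF ij(1,2)] show ?thesis by (metis dvd_diff_right_iff dvd_diff_commute)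
    qed
    then show ?case by blast
  qed
  then show ?thesis using ij by (metis le_add2 less_imp_le trans_le_add2)
qed

text \<open>
  The entry \<open>(j, i)\<close> of \<open>W (t I + p J) - (t I + p J) U - f V\<close>, where \<open>J\<close> maps the \<open>i\<close>-th basis vector to
  the next one and the last to zero.  Endomorphisms of the glued lattice correspond to matrices for
  which these entries vanish modulo \<open>h\<close>; the matrix \<open>V\<close> is the part that maps the quotient into the
  submodule.
\<close>

definition glue_defect ::
  "nat \<Rightarrow> nat \<Rightarrow> (nat \<Rightarrow> nat \<Rightarrow> int poly) \<Rightarrow> (nat \<Rightarrow> nat \<Rightarrow> int poly) \<Rightarrow> (nat \<Rightarrow> nat \<Rightarrow> int poly)
    \<Rightarrow> nat \<Rightarrow> nat \<Rightarrow> int poly" where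
  "glue_defect p m U V W j i =
     xm1 1 * W j i + (if Suc i < m then of_nat p * W j (Suc i) else 0)
     - xm1 p * V j i - xm1 1 * U j i - (if j = 0 then 0 else of_nat p * U (j - 1) i)"

lemma idem_mod_at_1:
  assumes W: "idem_mod m h W" and h: "c dvd poly h 1" and ij: "i < m" "j < m"
  shows "c dvd (\<Sum>k<m. poly (W i k) 1 * poly (W k j) 1) - poly (W i j) 1"
proof -
  obtain r where "(\<Sum>k<m. W i k * W k j) - W i j = h * r"
    using W ij unfolding idem_mod_def by (meson dvdE)
  then have "poly ((\<Sum>k<m. W i k * W k j) - W i j) 1 = poly h 1 * poly r 1" by simp
  then have "(\<Sum>k<m. poly (W i k) 1 * poly (W k j) 1) - poly (W i j) 1 = poly h 1 * poly r 1"
    by (simp add: poly_sum)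
  then show ?thesis using h by simp
qed

text \<open>
  Modulo the square of \<open>(p, x - 1)\<close> a polynomial is determined by its value at \<open>1\<close> modulo \<open>p\<^sup>2\<close> and
  its derivative at \<open>1\<close> modulo \<open>p\<close>.  The value isolates the coefficient of \<open>p\<close>, the derivative that of
  \<open>x - 1\<close>; the terms from \<open>f\<close> and \<open>h\<close> contribute nothing, as both lie in that square.
\<close>

lemma glue_defect_local:
  assumes p: "prime p" and N': "N' > 0" and h: "h = geo p (p\<^sup>2 * N')"
    and D: "h dvd glue_defect p m U V W j i"
  shows "int p dvd poly (W j i) 1 - poly (U j i) 1"
    and "int p dvd (if Suc i < m then poly (W j (Suc i)) 1 else 0)
                 - (if j = 0 then 0 else poly (U (j - 1) i) 1)"
proof -
  have p0: "p > 0" using p prime_gt_0_nat by blast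
  obtain r where r: "glue_defect p m U V W j i = h * r" using D by (elim dvdE)
  define a where "a = (if Suc i < m then W j (Suc i) else 0)"
  define b where "b = (if j = 0 then 0 else U (j - 1) i)"
  have D': "glue_defect p m U V W j i = xm1 1 * (W j i - U j i) + of_nat p * (a - b) - xm1 p * V j i"
    by (simp add: glue_defect_def a_def b_def algebra_simps)
  have "poly (glue_defect p m U V W j i) 1 = int p * poly (a - b) 1"
    unfolding D' by (simp add: poly_monom of_nat_poly)
  then have "int p * poly (a - b) 1 = int (p\<^sup>2 * N') * poly r 1"
    unfolding r by (simp add: h poly_geo_1)
  then have "int p * poly (a - b) 1 = int p * (int p * (int N' * poly r 1))"
    by (simp add: power2_eq_square mult.assoc)
  then have "poly (a - b) 1 = int p * (int N' * poly r 1)"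
    using p0 by (metis mult_cancel_left of_nat_0_less_iff less_irrefl)
  then have "int p dvd poly (a - b) 1" by simp
  then show "int p dvd (if Suc i < m then poly (W j (Suc i)) 1 else 0)
                 - (if j = 0 then 0 else poly (U (j - 1) i) 1)"
    by (simp add: a_def b_def split: if_splits)
  have der: "poly (pderiv (glue_defect p m U V W j i)) 1
      = poly (W j i) 1 - poly (U j i) 1 + int p * poly (pderiv (a - b)) 1 - int p * poly (V j i) 1"
    unfolding D' by (simp add: poly_monom of_nat_poly pderiv_diff pderiv_add pderiv_mult
        pderiv_monom pderiv_smult algebra_simps)
  have "int p dvd poly (pderiv h) 1" "int p dvd poly h 1"
    unfolding h using pderiv_geo_1 by (auto simp: poly_geo_1 power2_eq_square)
  then have "int p dvd poly (pderiv (h * r)) 1"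
    by (simp add: pderiv_mult)
  then have "int p dvd poly (W j i) 1 - poly (U j i) 1 + int p * poly (pderiv (a - b)) 1 - int p * poly (V j i) 1"
    unfolding r[symmetric] der .
  then show "int p dvd poly (W j i) 1 - poly (U j i) 1"
    by (metis add_diff_eq dvd_add_left_iff dvd_triv_left right_diff_distrib)
qed

text \<open>
  Commuting with the shift makes the entries constant along the diagonals; those above the main
  diagonal are zero because the shift brings zeros in at the first row.
\<close>

lemma glue_toeplitz:
  assumes p: "prime p" and N': "N' > 0" and h: "h = geo p (p\<^sup>2 * N')"
    and D: "\<And>i j. i < m \<Longrightarrow> j < m \<Longrightarrow> h dvd glue_defect p m U V W j i"
  shows "j < i \<Longrightarrow> i < m \<Longrightarrow> int p dvd poly (W j i) 1"
    and "j < m \<Longrightarrow> int p dvd poly (W j j) 1 - poly (W 0 0) 1"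
proof -
  let ?w = "\<lambda>j i. poly (W j i) 1"
  have step0: "int p dvd ?w 0 (Suc i)" if "Suc i < m" for i
    using glue_defect_local(2)[OF p N' h D, of i 0] that by simp
  have step: "int p dvd ?w (Suc j) (Suc i) - ?w j i" if "Suc i < m" "Suc j < m" for i j
  proof -
    have "int p dvd ?w (Suc j) (Suc i) - poly (U j i) 1"
      using glue_defect_local(2)[OF p N' h D, of i "Suc j"] that by simp
    moreover have "int p dvd ?w j i - poly (U j i) 1"
      using glue_defect_local(1)[OF p N' h D, of i j] that by simp
    ultimately have "int p dvd (?w (Suc j) (Suc i) - poly (U j i) 1) - (?w j i - poly (U j i) 1)"
      by (rule dvd_diff)
    then show ?thesis by simp
  qed
  show "int p dvd ?w j i" if "j < i" "i < m"
    using that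
  proof (induction j arbitrary: i)
    case 0
    then show ?case using step0[of "i - 1"] by simp
  next
    case (Suc j)
    then obtain i' where i: "i = Suc i'" by (cases i) auto
    then have "int p dvd ?w j i'" using Suc by simp
    with step[of i' j] Suc.prems i show ?case by (metis Suc_lessD dvd_diff_left_iff less_trans_Suc)
  qed
  show "int p dvd ?w j j - ?w 0 0" if "j < m"
    using that
  proof (induction j)
    case (Suc j)
    then have "int p dvd (?w (Suc j) (Suc j) - ?w j j) + (?w j j - ?w 0 0)"
      using step[of j j] by (intro dvd_add) auto
    then show ?case by simp
  qed simp
qed

lemma glue_idempotent_zero:
  assumes p: "prime p" and N': "N' > 0" and h: "h = geo p (p\<^sup>2 * N')"
    and D: "\<And>i j. i < m \<Longrightarrow> j < m \<Longrightarrow> h dvd glue_defect p m U V W j i"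
    and W: "idem_mod m h W" and U: "idem_mod m (xm1 p) U"
    and 0: "int p dvd poly (W 0 0) 1"
    and ij: "i < m" "j < m"
  shows "h dvd W i j \<and> xm1 p dvd U i j"
proof -
  have hp: "int p dvd poly h 1" by (simp add: h poly_geo_1 power2_eq_square)
  have tri: "int p dvd poly (W i j) 1" if "i \<le> j" "j < m" for i j
  proof (cases "i = j")
    case True
    then show ?thesis
      using glue_toeplitz(2)[OF p N' h D, of i] that 0 by (metis dvd_diff_left_iff)
  next
    case False
    then show ?thesis using glue_toeplitz(1)[OF p N' h D, of i j] that by simp
  qed
  have w: "int p dvd poly (W i j) 1" if "i < m" "j < m" for i j
    using idempotent_lower_triangular_mod[where w = "\<lambda>i j. poly (W i j) 1",
        OF idem_mod_at_1[OF W hp] tri that] by blast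
  have u: "int p dvd poly (U i j) 1" if "i < m" "j < m" for i j
    using glue_defect_local(1)[OF p N' h D, of j i] w[OF that] that
    by (metis dvd_diff_right_iff)
  show ?thesis
    using idem_mod_augmentation_zero_geo[OF p N' W[unfolded h] w ij]
      idem_mod_augmentation_zero_xm1[OF p U u ij] h by blast
qed

lemma idem_mod_complement:
  assumes "idem_mod m h W"
  shows "idem_mod m h (\<lambda>i j. of_bool (i = j) - W i j)"
  unfolding idem_mod_def
proof (intro allI impI)
  fix i j assume ij: "i < m" "j < m"
  have "(\<Sum>k<m. (of_bool (i = k) - W i k) * (of_bool (k = j) - W k j))
      = (\<Sum>k<m. (if k = i then of_bool (k = j) else 0)) - (\<Sum>k<m. (if k = i then W k j else 0))
        - (\<Sum>k<m. (if k = j then W i k else 0)) + (\<Sum>k<m. W i k * W k j)"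
    unfolding sum_subtractf[symmetric] sum.distrib[symmetric]
    by (intro sum.cong refl) (auto simp: algebra_simps)
  then have eq: "(\<Sum>k<m. (of_bool (i = k) - W i k) * (of_bool (k = j) - W k j)) - (of_bool (i = j) - W i j)
      = (\<Sum>k<m. W i k * W k j) - W i j"
    using ij by (simp add: sum.delta)
  then show "h dvd (\<Sum>k<m. (of_bool (i = k) - W i k) * (of_bool (k = j) - W k j)) - (of_bool (i = j) - W i j)"
    unfolding eq using assms ij by (simp add: idem_mod_def)
qed

lemma glue_defect_complement:
  assumes "i < m" "j < m"
  shows "glue_defect p m (\<lambda>i j. of_bool (i = j) - U i j) (\<lambda>i j. - V i j) (\<lambda>i j. of_bool (i = j) - W i j) j i
    = - glue_defect p m U V W j i"
  using assms by (cases j) (auto simp: glue_defect_def algebra_simps)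

text \<open>
  The matrix form of indecomposability.  The common diagonal entry of \<open>W\<close> at \<open>1\<close> is idempotent modulo
  \<open>p\<close>, and the value \<open>1\<close> is exchanged with \<open>0\<close> by passing to the complement.
\<close>

lemma glue_idempotent_trivial:
  assumes p: "prime p" and N': "N' > 0" and h: "h = geo p (p\<^sup>2 * N')" and m: "m > 0"
    and D: "\<And>i j. i < m \<Longrightarrow> j < m \<Longrightarrow> h dvd glue_defect p m U V W j i"
    and W: "idem_mod m h W" and U: "idem_mod m (xm1 p) U"
  shows "(\<forall>i<m. \<forall>j<m. h dvd W i j \<and> xm1 p dvd U i j) \<or>
    (\<forall>i<m. \<forall>j<m. h dvd of_bool (i = j) - W i j \<and> xm1 p dvd of_bool (i = j) - U i j)"
proof -
  let ?c = "poly (W 0 0) 1"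
  have hp: "int p dvd poly h 1" by (simp add: h poly_geo_1 power2_eq_square)
  have "int p dvd (\<Sum>k<m. poly (W 0 k) 1 * poly (W k 0) 1) - ?c"
    using idem_mod_at_1[OF W hp m m] .
  moreover have "(\<Sum>k<m. poly (W 0 k) 1 * poly (W k 0) 1)
      = ?c * ?c + (\<Sum>k\<in>{..<m} - {0}. poly (W 0 k) 1 * poly (W k 0) 1)"
    using m by (subst sum.remove[of _ 0]) auto
  moreover have "int p dvd (\<Sum>k\<in>{..<m} - {0}. poly (W 0 k) 1 * poly (W k 0) 1)"
    using glue_toeplitz(1)[OF p N' h D] by (intro dvd_sum dvd_mult2) auto
  \<comment> \<open>Only the diagonal entry survives in the first row, so it is idempotent modulo \<open>p\<close>.\<close>
  ultimately have "int p dvd ?c * ?c - ?c"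
    by (smt (verit) dvd_add_right_iff)
  then have "int p dvd ?c * (?c - 1)" by (simp add: algebra_simps)
  then have "int p dvd ?c \<or> int p dvd ?c - 1"
    using p by (simp add: prime_dvd_mult_iff)
  then show ?thesis
  proof
    assume "int p dvd ?c"
    then show ?thesis using glue_idempotent_zero[OF p N' h D W U] by blast
  next
    assume "int p dvd ?c - 1"
    then have "int p dvd - (?c - 1)" by (simp only: dvd_minus_iff)
    then have 0: "int p dvd poly (of_bool (0 = (0::nat)) - W 0 0) 1" by simp
    have "h dvd glue_defect p m (\<lambda>i j. of_bool (i = j) - U i j) (\<lambda>i j. - V i j)
        (\<lambda>i j. of_bool (i = j) - W i j) j i" if "i < m" "j < m" for i j
      using D[OF that] glue_defect_complement[OF that] by simp
    from glue_idempotent_zero[OF p N' h this idem_mod_complement[OF W] idem_mod_complement[OF U] 0]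
    show ?thesis by blast
  qed
qed

section \<open>The glued lattice and the action of the generator\<close>

locale glued_module =
  fixes p N' m :: nat
  assumes p: "prime p" and N': "N' > 0" and m: "m > 0"
begin

definition N :: nat where "N = p ^ 3 * N'"
definition h :: "int poly" where "h = geo p (p\<^sup>2 * N')"

abbreviation f :: "int poly" where "f \<equiv> xm1 p"
abbreviation t :: "int poly" where "t \<equiv> xm1 1"
abbreviation X :: "nat \<Rightarrow> int poly" where "X k \<equiv> Polynomial.monom 1 k"

lemma p1: "p > 1" using p prime_gt_1_nat by blast

lemma p_less_N: "p < N"
proof -
  have "p * 1 < p * (p * p)" using p1 using less_1_mult[of p p] by (intro mult_strict_left_mono) auto
  also have "\<dots> \<le> p * (p * p) * N'" using N' by simp
  finally show ?thesis by (simp add: N_def power3_eq_cube mult.assoc)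
qed

lemma f: "monic_nonconst f" and degree_f: "degree f = p"
  using monic_xm1 degree_xm1 p1 by auto

lemma h: "monic_nonconst h" and degree_h: "degree h = N - p"
proof -
  have "1 < p\<^sup>2" using p1 one_less_power[of p 2] by simp
  also have "\<dots> \<le> p\<^sup>2 * N'" using N' by simp
  finally have 1: "p\<^sup>2 * N' > 1" .
  show "monic_nonconst h" "degree h = N - p"
    unfolding h_def using monic_geo[OF _ 1, of p] p1
    by (simp_all add: N_def power2_eq_square power3_eq_cube mult.assoc)
qed

lemma fh: "f * h = xm1 N"
  by (simp add: h_def geo_mult N_def power2_eq_square power3_eq_cube mult.assoc)

text \<open>
  Reducing the coefficients \<open>u\<close> of the \<open>a\<^sub>i\<close> modulo \<open>f\<close> by means of \<open>f a\<^sub>i = t b\<^sub>i + p b\<^sub>i\<^sub>+\<^sub>1\<close> adds this amount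
  to the coefficient of \<open>b\<^sub>i\<close>.
\<close>

definition carry :: "(nat \<Rightarrow> int poly) \<Rightarrow> nat \<Rightarrow> int poly" where
  "carry u i = t * quo f (u i) + (if i = 0 then 0 else of_nat p * quo f (u (i - 1)))"

text \<open>
  Coordinates of \<open>\<Sum>\<^sub>i (u\<^sub>i a\<^sub>i + v\<^sub>i b\<^sub>i)\<close> in the \<open>\<int>\<close>-basis \<open>x\<^sup>j a\<^sub>i\<close> (\<open>j < p\<close>), \<open>x\<^sup>j b\<^sub>i\<close> (\<open>j < N - p\<close>): block \<open>i\<close>
  has length \<open>N\<close>, with the \<open>p\<close> coordinates at \<open>a\<^sub>i\<close> first.
\<close>

definition coord :: "(nat \<Rightarrow> int poly) \<Rightarrow> (nat \<Rightarrow> int poly) \<Rightarrow> nat \<Rightarrow> int" where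
  "coord u v r = (if r mod N < p then poly.coeff (remd f (u (r div N))) (r mod N)
     else poly.coeff (remd h (v (r div N) + carry u (r div N))) (r mod N - p))"

lemma carry_add: "carry (\<lambda>i. u i + u' i) i = carry u i + carry u' i"
  by (simp add: carry_def quo_add[OF f] algebra_simps)

lemma carry_smult: "carry (\<lambda>i. Polynomial.smult c (u i)) i = Polynomial.smult c (carry u i)"
  by (simp add: carry_def quo_smult[OF f] smult_add_right)

lemma carry_f: "carry (\<lambda>i. f * c i) i = t * c i + (if i = 0 then 0 else of_nat p * c (i - 1))"
  by (simp add: carry_def quo_mult[OF f])

lemma carry_small: "(\<And>i. degree (u i) < p) \<Longrightarrow> carry u i = 0"
  by (simp add: carry_def quo_small[OF f] degree_f)

lemma coord_add: "coord (\<lambda>i. u i + u' i) (\<lambda>i. v i + v' i) r = coord u v r + coord u' v' r"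
proof -
  have "remd h (v i + v' i + carry (\<lambda>i. u i + u' i) i)
      = remd h (v i + carry u i) + remd h (v' i + carry u' i)" for i
    unfolding carry_add remd_add[OF h, symmetric] by (simp add: algebra_simps)
  then show ?thesis by (simp add: coord_def remd_add[OF f])
qed

lemma coord_smult: "coord (\<lambda>i. Polynomial.smult c (u i)) (\<lambda>i. Polynomial.smult c (v i)) r = c * coord u v r"
proof -
  have "remd h (Polynomial.smult c (v i) + carry (\<lambda>i. Polynomial.smult c (u i)) i)
      = Polynomial.smult c (remd h (v i + carry u i))" for i
    unfolding carry_smult smult_add_right[symmetric] remd_smult[OF h] ..
  then show ?thesis by (simp add: coord_def remd_smult[OF f])
qed

lemma coord_0: "coord (\<lambda>i. 0) (\<lambda>i. 0) r = 0"
  using coord_smult[of 0 "\<lambda>i. 0" "\<lambda>i. 0" r] by simp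

lemma coord_diff: "coord (\<lambda>i. u i - u' i) (\<lambda>i. v i - v' i) r = coord u v r - coord u' v' r"
proof -
  have "coord (\<lambda>i. u i - u' i + u' i) (\<lambda>i. v i - v' i + v' i) r
      = coord (\<lambda>i. u i - u' i) (\<lambda>i. v i - v' i) r + coord u' v' r"
    by (rule coord_add)
  then show ?thesis by simp
qed

lemma coord_sum: "coord (\<lambda>i. \<Sum>c\<in>A. u c i) (\<lambda>i. \<Sum>c\<in>A. v c i) r = (\<Sum>c\<in>A. coord (u c) (v c) r)"
  by (induction A rule: infinite_finite_induct) (simp_all add: coord_0 coord_add)

lemma index: "j < N \<Longrightarrow> i < m \<Longrightarrow> i * N + j < m * N"
  "j < N \<Longrightarrow> (i * N + j) div N = i" "j < N \<Longrightarrow> (i * N + j) mod N = j"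
proof -
  assume "j < N" "i < m"
  then have "i * N + j < Suc i * N" by simp
  also have "\<dots> \<le> m * N" using \<open>i < m\<close> by (intro mult_le_mono1) simp
  finally show "i * N + j < m * N" .
qed auto

lemma block_less: "r < m * N \<Longrightarrow> r div N < m" and offset_less: "r mod N < N"
  using p_less_N by (auto simp: less_mult_imp_div_less)

text \<open>
  This describes the module of relations between the generators.
\<close>

lemma coord_eq_0_iff:
  "(\<forall>r<m * N. coord u v r = 0) \<longleftrightarrow> (\<forall>i<m. f dvd u i \<and> h dvd v i + carry u i)"
proof
  assume L: "\<forall>r<m * N. coord u v r = 0"
  show "\<forall>i<m. f dvd u i \<and> h dvd v i + carry u i"
  proof (intro allI impI conjI)
    fix i assume i: "i < m"
    have "poly.coeff (remd f (u i)) j = 0" if "j < p" for j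
      using L index[of j i] that i p_less_N by (fastforce simp: coord_def)
    then show "f dvd u i" unfolding remd_0_coeff_iff[OF f, symmetric] degree_f by blast
    have "poly.coeff (remd h (v i + carry u i)) j = 0" if "j < N - p" for j
    proof -
      have "j + p < N" using that by simp
      then have "coord u v (i * N + (j + p)) = 0" using L index[of "j + p" i] i by simp
      then show ?thesis using index[of "j + p" i] \<open>j + p < N\<close> by (simp add: coord_def)
    qed
    then show "h dvd v i + carry u i"
      unfolding remd_0_coeff_iff[OF h, symmetric] degree_h by blast
  qed
next
  assume R: "\<forall>i<m. f dvd u i \<and> h dvd v i + carry u i"
  show "\<forall>r<m * N. coord u v r = 0"
  proof (intro allI impI)
    fix r assume "r < m * N"
    then have "remd f (u (r div N)) = 0" "remd h (v (r div N) + carry u (r div N)) = 0"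
      using R block_less remd_eq_0_iff f h by auto
    then show "coord u v r = 0" by (simp add: coord_def)
  qed
qed

lemma carry_mult_of_dvd:
  assumes "\<forall>i<m. f dvd u i" "i < m"
  shows "carry (\<lambda>i. q * u i) i = q * carry u i"
proof -
  have q: "quo f (q * u i) = q * quo f (u i)" if i: "i < m" for i
  proof -
    obtain c where "u i = f * c" using assms(1) i by (meson dvdE)
    then show ?thesis using quo_mult[OF f] by (metis mult.left_commute)
  qed
  show ?thesis
    using assms(2) q[of i] q[of "i - 1"] by (simp add: carry_def algebra_simps)
qed

text \<open>
  The relations form a \<open>\<int>[x]\<close>-submodule; this is what makes the action of \<open>x\<close> on the lattice well
  defined.
\<close>

lemma coord_mult_eq_0:
  assumes "\<forall>r<m * N. coord u v r = 0"
  shows "\<forall>r<m * N. coord (\<lambda>i. q * u i) (\<lambda>i. q * v i) r = 0"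
proof -
  have R: "\<forall>i<m. f dvd u i \<and> h dvd v i + carry u i" using assms coord_eq_0_iff by blast
  have "f dvd q * u i \<and> h dvd q * v i + carry (\<lambda>i. q * u i) i" if "i < m" for i
  proof -
    have "q * v i + carry (\<lambda>i. q * u i) i = q * (v i + carry u i)"
      using carry_mult_of_dvd[of u i q] R that by (simp add: algebra_simps)
    then show ?thesis using R that by simp
  qed
  then show ?thesis using coord_eq_0_iff by blast
qed

lemma coord_mult_cong:
  assumes "\<forall>r<m * N. coord u v r = coord u' v' r" and "r < m * N"
  shows "coord (\<lambda>i. q * u i) (\<lambda>i. q * v i) r = coord (\<lambda>i. q * u' i) (\<lambda>i. q * v' i) r"
proof -
  have "\<forall>r<m * N. coord (\<lambda>i. u i - u' i) (\<lambda>i. v i - v' i) r = 0"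
    using assms(1) by (simp add: coord_diff)
  then have "coord (\<lambda>i. q * (u i - u' i)) (\<lambda>i. q * (v i - v' i)) r = 0"
    using coord_mult_eq_0 assms(2) by blast
  then show ?thesis by (simp add: coord_diff right_diff_distrib)
qed

text \<open>
  \<open>gen_u c\<close> and \<open>gen_v c\<close> are the coefficients at the \<open>a\<^sub>i\<close> and at the \<open>b\<^sub>i\<close> of the \<open>c\<close>-th basis element;
  \<open>rep_u z\<close> and \<open>rep_v z\<close> below are those of the element with coordinates \<open>z\<close>.
\<close>

definition gen_u :: "nat \<Rightarrow> nat \<Rightarrow> int poly" where
  "gen_u c i = (if i = c div N \<and> c mod N < p then X (c mod N) else 0)"

definition gen_v :: "nat \<Rightarrow> nat \<Rightarrow> int poly" where
  "gen_v c i = (if i = c div N \<and> \<not> c mod N < p then X (c mod N - p) else 0)"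

lemma coord_gen: "coord (gen_u c) (gen_v c) r = of_bool (r = c)"
proof -
  have du: "degree (gen_u c i) < p" for i
    using p1 by (auto simp: gen_u_def degree_monom_eq)
  have dv: "degree (gen_v c i) < N - p" for i
    using p_less_N offset_less[of c] by (auto simp: gen_v_def degree_monom_eq intro: diff_less_mono)
  have "remd f (gen_u c i) = gen_u c i" "remd h (gen_v c i + carry (gen_u c) i) = gen_v c i" for i
    using du dv by (simp_all add: carry_small remd_small[OF f] remd_small[OF h] degree_f degree_h)
  moreover have "r = c \<longleftrightarrow> r div N = c div N \<and> r mod N = c mod N"
    by (metis div_mult_mod_eq)
  ultimately show ?thesis
    by (auto simp: coord_def gen_u_def gen_v_def)
qed

definition rep_u :: "(nat \<Rightarrow> int) \<Rightarrow> nat \<Rightarrow> int poly" where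
  "rep_u z i = (\<Sum>c<m * N. Polynomial.smult (z c) (gen_u c i))"

definition rep_v :: "(nat \<Rightarrow> int) \<Rightarrow> nat \<Rightarrow> int poly" where
  "rep_v z i = (\<Sum>c<m * N. Polynomial.smult (z c) (gen_v c i))"

lemma coord_mult_rep:
  "coord (\<lambda>i. q * rep_u z i) (\<lambda>i. q * rep_v z i) r
    = (\<Sum>c<m * N. z c * coord (\<lambda>i. q * gen_u c i) (\<lambda>i. q * gen_v c i) r)"
  unfolding rep_u_def rep_v_def sum_distrib_left mult_smult_right coord_sum coord_smult ..

lemma coord_rep: "r < m * N \<Longrightarrow> coord (rep_u z) (rep_v z) r = z r"
  using coord_mult_rep[of 1 z r] by (simp add: coord_gen)

definition elem :: "(nat \<Rightarrow> int poly) \<Rightarrow> (nat \<Rightarrow> int poly) \<Rightarrow> real vec" where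
  "elem u v = vec (m * N) (\<lambda>r. real_of_int (coord u v r))"

definition act :: "nat \<Rightarrow> real mat" where
  "act k = mat (m * N) (m * N) (\<lambda>(r, c). real_of_int (coord (\<lambda>i. X k * gen_u c i) (\<lambda>i. X k * gen_v c i) r))"

lemma elem_carrier [simp]: "elem u v \<in> carrier_vec (m * N)"
  and dim_elem [simp]: "dim_vec (elem u v) = m * N"
  by (auto simp: elem_def)

lemma elem_index: "r < m * N \<Longrightarrow> elem u v $ r = real_of_int (coord u v r)"
  by (simp add: elem_def)

lemma act_carrier [simp]: "act k \<in> carrier_mat (m * N) (m * N)"
  by (simp add: act_def)

lemma elem_eq_iff: "elem u v = elem u' v' \<longleftrightarrow> (\<forall>r<m * N. coord u v r = coord u' v' r)"
  by (auto simp: elem_def vec_eq_iff)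

lemma elem_add: "elem u v + elem u' v' = elem (\<lambda>i. u i + u' i) (\<lambda>i. v i + v' i)"
  by (rule eq_vecI) (auto simp: elem_index coord_add)

lemma elem_diff: "elem u v - elem u' v' = elem (\<lambda>i. u i - u' i) (\<lambda>i. v i - v' i)"
  by (rule eq_vecI) (auto simp: elem_index coord_diff)

lemma elem_0: "elem (\<lambda>i. 0) (\<lambda>i. 0) = 0\<^sub>v (m * N)"
  by (rule eq_vecI) (auto simp: elem_index coord_0)

lemma elem_eq_0_iff: "elem u v = 0\<^sub>v (m * N) \<longleftrightarrow> (\<forall>i<m. f dvd u i \<and> h dvd v i + carry u i)"
  unfolding elem_0[symmetric] elem_eq_iff coord_0 coord_eq_0_iff ..

lemma act_elem: "act k *\<^sub>v elem u v = elem (\<lambda>i. X k * u i) (\<lambda>i. X k * v i)"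
proof (rule eq_vecI)
  fix r assume "r < dim_vec (elem (\<lambda>i. X k * u i) (\<lambda>i. X k * v i))"
  then have r: "r < m * N" by simp
  define z where "z = coord u v"
  have "\<forall>r<m * N. coord u v r = coord (rep_u z) (rep_v z) r" by (simp add: coord_rep z_def)
  note cong = coord_mult_cong[OF this r, of "X k"]
  have "(act k *\<^sub>v elem u v) $ r = (\<Sum>c<m * N. act k $$ (r, c) * elem u v $ c)"
    using r by (simp add: act_def scalar_prod_def atLeast0LessThan)
  also have "\<dots> = real_of_int (\<Sum>c<m * N. z c * coord (\<lambda>i. X k * gen_u c i) (\<lambda>i. X k * gen_v c i) r)"
    using r by (simp add: act_def elem_index z_def mult.commute)
  also have "\<dots> = real_of_int (coord (\<lambda>i. X k * u i) (\<lambda>i. X k * v i) r)"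
    unfolding coord_mult_rep[symmetric] cong ..
  finally show "(act k *\<^sub>v elem u v) $ r = elem (\<lambda>i. X k * u i) (\<lambda>i. X k * v i) $ r"
    using r by (simp add: elem_index)
qed (simp add: act_def)

lemma elem_gen: "c < m * N \<Longrightarrow> elem (gen_u c) (gen_v c) = unit_vec (m * N) c"
  by (rule eq_vecI) (auto simp: elem_index coord_gen)

text \<open>
  The elements of the lattice include the unit vectors, so a real matrix is determined by its action
  on them.
\<close>

lemma mat_eqI_elem:
  assumes A: "A \<in> carrier_mat (m * N) (m * N)" and B: "B \<in> carrier_mat (m * N) (m * N)"
    and eq: "\<And>u v. A *\<^sub>v elem u v = B *\<^sub>v elem u v"
  shows "A = B"
proof (rule eq_matI)
  fix r c assume "r < dim_row B" "c < dim_col B"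
  then have rc: "r < m * N" "c < m * N" using B by auto
  have "A *\<^sub>v unit_vec (m * N) c = B *\<^sub>v unit_vec (m * N) c"
    using eq[of "gen_u c" "gen_v c"] rc by (simp add: elem_gen)
  then have "(A *\<^sub>v unit_vec (m * N) c) $ r = (B *\<^sub>v unit_vec (m * N) c) $ r" by simp
  then show "A $$ (r, c) = B $$ (r, c)"
    using A B rc by (simp add: scalar_prod_right_unit)
qed (use A B in auto)

lemma act_add: "act (k + l) = act k * act l"
proof (rule mat_eqI_elem)
  fix u v
  have "act k * act l *\<^sub>v elem u v = act k *\<^sub>v (act l *\<^sub>v elem u v)"
    by (rule assoc_mult_mat_vec[of _ "m * N" "m * N" _ "m * N"]) auto
  also have "\<dots> = act (k + l) *\<^sub>v elem u v"
    by (simp add: act_elem mult.assoc[symmetric] mult_monom)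
  finally show "act (k + l) *\<^sub>v elem u v = act k * act l *\<^sub>v elem u v" ..
qed (auto intro: mult_carrier_mat[of _ _ "m * N"])

lemma act_0: "act 0 = 1\<^sub>m (m * N)"
  by (rule mat_eqI_elem) (auto simp: act_elem)

text \<open>
  \<open>x\<^sup>N - 1 = f h\<close> kills the \<open>b\<^sub>i\<close>, and hence also the \<open>a\<^sub>i\<close> since \<open>f a\<^sub>i\<close> is a combination of them.
\<close>

lemma act_N: "act N = 1\<^sub>m (m * N)"
proof (rule mat_eqI_elem)
  fix u v
  have XN: "X N * w - w = f * (h * w)" for w
    unfolding mult.assoc[symmetric] fh by (simp add: left_diff_distrib)
  have "elem (\<lambda>i. X N * u i) (\<lambda>i. X N * v i) - elem u v
      = elem (\<lambda>i. f * (h * u i)) (\<lambda>i. f * (h * v i))"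
    unfolding elem_diff XN ..
  also have "\<dots> = 0\<^sub>v (m * N)"
    unfolding elem_eq_0_iff carry_f by (auto intro!: dvd_add)
  finally have "elem (\<lambda>i. X N * u i) (\<lambda>i. X N * v i) - elem u v = 0\<^sub>v (m * N)" .
  then have "\<forall>r<m * N. (elem (\<lambda>i. X N * u i) (\<lambda>i. X N * v i) - elem u v) $ r = 0" by simp
  then have "elem (\<lambda>i. X N * u i) (\<lambda>i. X N * v i) = elem u v"
    by (intro eq_vecI) auto
  then show "act N *\<^sub>v elem u v = 1\<^sub>m (m * N) *\<^sub>v elem u v"
    by (simp add: act_elem)
qed auto

lemma act_mod: "act k = act (k mod N)"
proof -
  have "act (N * n) = 1\<^sub>m (m * N)" for n
    by (induction n) (simp_all add: act_0 act_add act_N)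
  then have "act (N * (k div N) + k mod N) = 1\<^sub>m (m * N) * act (k mod N)"
    by (simp only: act_add)
  also have "\<dots> = act (k mod N)" by (rule left_mult_one_mat) (rule act_carrier)
  finally show ?thesis by simp
qed

definition M :: "real vec set" where
  "M = {elem u v | u v. True}"

lemma M_iff: "x \<in> M \<longleftrightarrow> x \<in> carrier_vec (m * N) \<and> (\<forall>r<m * N. x $ r \<in> \<int>)"
proof
  assume "x \<in> M"
  then show "x \<in> carrier_vec (m * N) \<and> (\<forall>r<m * N. x $ r \<in> \<int>)"
    by (auto simp: M_def elem_index)
next
  assume R: "x \<in> carrier_vec (m * N) \<and> (\<forall>r<m * N. x $ r \<in> \<int>)"
  define z where "z r = \<lfloor>x $ r\<rfloor>" for r
  have "x = elem (rep_u z) (rep_v z)"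
    using R by (intro eq_vecI) (auto simp: elem_index coord_rep z_def floor_of_int elim!: Ints_cases)
  then show "x \<in> M" by (auto simp: M_def)
qed

lemma full_lattice_M: "full_lattice (m * N) M"
proof -
  interpret vs: vec_space "TYPE(real)" "m * N" .
  let ?d = "m * N"
  let ?B = "set (unit_vecs ?d)"
  have B: "?B \<subseteq> carrier_vec ?d" by (rule unit_vecs_carrier)
  have Bim: "?B = unit_vec ?d ` {..<?d}" by (auto simp: unit_vecs_def)
  have inj: "inj_on (unit_vec ?d :: nat \<Rightarrow> real vec) {..<?d}"
    by (auto simp: inj_on_def)
  have idx: "vs.lincomb a ?B $ r = a (unit_vec ?d r)" if r: "r < ?d" for a r
  proof -
    have "vs.lincomb a ?B $ r = (\<Sum>b\<in>?B. a b * b $ r)"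
      using vs.lincomb_index[OF r B] .
    also have "\<dots> = (\<Sum>k<?d. a (unit_vec ?d k) * unit_vec ?d k $ r)"
      unfolding Bim by (simp add: sum.reindex[OF inj])
    also have "\<dots> = (\<Sum>k<?d. if k = r then a (unit_vec ?d r) else 0)"
      using r by (intro sum.cong) auto
    finally show ?thesis using r by simp
  qed
  have lc: "vs.lincomb a ?B \<in> carrier_vec ?d" for a
    using vs.lincomb_dim[OF _ B] by (intro carrier_vecI) simp
  have "M = {vs.lincomb (\<lambda>b. real_of_int (a b)) ?B | a. True}" (is "_ = ?R")
  proof (intro equalityI subsetI)
    fix x assume "x \<in> M"
    then have x: "x \<in> carrier_vec ?d" "\<forall>r<?d. x $ r \<in> \<int>" using M_iff by auto
    define a where "a b = \<lfloor>\<Sum>k<?d. b $ k * x $ k\<rfloor>" for b :: "real vec"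
    have a_unit: "a (unit_vec ?d r) = \<lfloor>x $ r\<rfloor>" if r: "r < ?d" for r
    proof -
      have "(\<Sum>k<?d. unit_vec ?d r $ k * x $ k) = (\<Sum>k<?d. if k = r then x $ r else 0)"
        using r by (intro sum.cong) auto
      then show ?thesis using r by (simp add: a_def)
    qed
    then have "x = vs.lincomb (\<lambda>b. real_of_int (a b)) ?B"
    proof (intro eq_vecI)
      fix r assume "r < dim_vec (vs.lincomb (\<lambda>b. real_of_int (a b)) ?B)"
      then have r: "r < ?d" using lc[of "\<lambda>b. real_of_int (a b)"] by auto
      have "vs.lincomb (\<lambda>b. real_of_int (a b)) ?B $ r = real_of_int \<lfloor>x $ r\<rfloor>"
        unfolding idx[OF r] a_unit[OF r] ..
      also have "\<dots> = x $ r" using x r by (metis Ints_cases floor_of_int)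
      finally show "x $ r = vs.lincomb (\<lambda>b. real_of_int (a b)) ?B $ r" ..
    qed (use x lc[of "\<lambda>b. real_of_int (a b)"] in auto)
    then show "x \<in> ?R" by blast
  next
    fix x assume "x \<in> ?R"
    then show "x \<in> M" using lc by (auto simp: M_iff idx)
  qed
  moreover have "vs.basis ?B" by (rule vs.unit_vecs_basis)
  ultimately show ?thesis unfolding full_lattice_def by blast
qed

section \<open>Submodules and the projection of a decomposition\<close>

lemma elem_cong: "(\<And>i. i < m \<Longrightarrow> u i = u' i) \<Longrightarrow> (\<And>i. i < m \<Longrightarrow> v i = v' i) \<Longrightarrow> elem u v = elem u' v'"
proof -
  assume *: "\<And>i. i < m \<Longrightarrow> u i = u' i" "\<And>i. i < m \<Longrightarrow> v i = v' i"
  have "carry u i = carry u' i" if "i < m" for i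
    using * that by (simp add: carry_def)
  then show ?thesis
    using * block_less by (auto simp: elem_eq_iff coord_def)
qed

lemma elem_eq_dvd_iff:
  "elem u v = elem u' v' \<longleftrightarrow>
    (\<forall>i<m. f dvd u i - u' i \<and> h dvd (v i - v' i) + carry (\<lambda>i. u i - u' i) i)"
proof -
  have "elem u v = elem u' v' \<longleftrightarrow> elem u v - elem u' v' = 0\<^sub>v (m * N)"
    by (auto simp: vec_eq_iff)
  then show ?thesis by (simp add: elem_diff elem_eq_0_iff)
qed

lemma carry_0: "carry (\<lambda>i. 0) i = 0"
  using carry_f[of "\<lambda>i. 0" i] by simp

lemma elem_b_eq_iff: "elem (\<lambda>i. 0) v = elem (\<lambda>i. 0) v' \<longleftrightarrow> (\<forall>i<m. h dvd v i - v' i)"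
  by (simp add: elem_eq_dvd_iff carry_0)

lemma elem_move_carry:
  assumes "\<forall>i<m. f dvd u i"
  shows "elem u v = elem (\<lambda>i. 0) (\<lambda>i. v i + carry u i)"
  using assms by (simp add: elem_eq_dvd_iff)

text \<open>
  Modulo \<open>f\<close> every summand \<open>x^(p j)\<close> of \<open>h\<close> is \<open>1\<close>, so \<open>h\<close> acts as a nonzero integer.  Consequently the
  span of the \<open>b\<^sub>i\<close> is exactly the kernel of \<open>h\<close>, and endomorphisms preserve it.
\<close>

lemma f_dvd_of_dvd_h_mult:
  assumes "f dvd h * w"
  shows "f dvd w"
proof -
  have "f dvd (\<Sum>j<p\<^sup>2 * N'. xm1 (p * j))" by (intro dvd_sum xm1_dvd)
  then have "f dvd h - of_nat (p\<^sup>2 * N')"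
    by (simp add: h_def geo_def sum_subtractf)
  then have "f dvd (h - of_nat (p\<^sup>2 * N')) * w" by simp
  with assms have "f dvd h * w - (h - of_nat (p\<^sup>2 * N')) * w" by (rule dvd_diff)
  also have "h * w - (h - of_nat (p\<^sup>2 * N')) * w = Polynomial.smult (int (p\<^sup>2 * N')) w"
    by (simp add: algebra_simps of_nat_poly)
  finally have dvd: "f dvd Polynomial.smult (int (p\<^sup>2 * N')) w" .
  have "int (p\<^sup>2 * N') \<noteq> 0" using p1 N' by simp
  from monic_dvd_of_dvd_smult[OF f this dvd] show ?thesis .
qed

text \<open>
  A \<open>\<int>G\<close>-submodule, expressed through the generator alone.
\<close>

definition stable :: "real vec set \<Rightarrow> bool" where
  "stable K \<longleftrightarrow> K \<subseteq> M \<and> 0\<^sub>v (m * N) \<in> K \<and> (\<forall>x\<in>K. \<forall>y\<in>K. x + y \<in> K \<and> x - y \<in> K) \<and>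
     (\<forall>x\<in>K. act 1 *\<^sub>v x \<in> K)"

lemma stable_elem: "stable K \<Longrightarrow> x \<in> K \<Longrightarrow> \<exists>u v. x = elem u v"
  by (auto simp: stable_def M_def)

lemma stable_elem_add:
  assumes "stable K" "elem u v \<in> K" "elem u' v' \<in> K"
  shows "elem (\<lambda>i. u i + u' i) (\<lambda>i. v i + v' i) \<in> K"
  using assms by (auto simp: stable_def simp flip: elem_add)

lemma stable_elem_smult:
  assumes K: "stable K" and elem: "elem u v \<in> K"
  shows "elem (\<lambda>i. Polynomial.smult a (u i)) (\<lambda>i. Polynomial.smult a (v i)) \<in> K"
proof (induction a rule: int_induct[where k = 0])
  case base
  show ?case using K by (simp add: elem_0 stable_def)
next
  case (step1 a)
  show ?case using stable_elem_add[OF K step1(2) elem] by (simp add: smult_add_left)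
next
  case (step2 a)
  have "elem (\<lambda>i. Polynomial.smult a (u i)) (\<lambda>i. Polynomial.smult a (v i)) - elem u v \<in> K"
    using K elem step2(2) by (auto simp: stable_def)
  then show ?case by (simp add: elem_diff smult_diff_left)
qed

lemma stable_elem_mult:
  assumes K: "stable K" and elem: "elem u v \<in> K"
  shows "elem (\<lambda>i. q * u i) (\<lambda>i. q * v i) \<in> K"
proof (induction q)
  case 0
  show ?case using K by (simp add: elem_0 stable_def)
next
  case (pCons a q)
  have X1: "X 1 * w = pCons 0 w" for w by (simp add: monom_altdef)
  have "act 1 *\<^sub>v elem (\<lambda>i. q * u i) (\<lambda>i. q * v i) \<in> K"
    using K pCons.IH by (auto simp: stable_def)
  then have "elem (\<lambda>i. pCons 0 (q * u i)) (\<lambda>i. pCons 0 (q * v i)) \<in> K"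
    by (simp only: act_elem X1)
  from stable_elem_add[OF K stable_elem_smult[OF K elem, of a] this]
  show ?case by (simp add: mult_pCons_left)
qed

end

locale split_glued_module = glued_module +
  fixes N\<^sub>1 N\<^sub>2 :: "real vec set"
  assumes N1: "stable N\<^sub>1" and N2: "stable N\<^sub>2"
    and disj: "N\<^sub>1 \<inter> N\<^sub>2 = {0\<^sub>v (m * N)}"
    and span: "\<And>x. x \<in> M \<Longrightarrow> \<exists>y\<in>N\<^sub>1. \<exists>z\<in>N\<^sub>2. x = y + z"
begin

text \<open>
  The projection onto the first summand as a relation between coefficient tuples.  It avoids a choice
  of representatives: by \<open>proj_unique\<close> it is a function on the lattice.
\<close>

definition proj ::
  "(nat \<Rightarrow> int poly) \<Rightarrow> (nat \<Rightarrow> int poly) \<Rightarrow> (nat \<Rightarrow> int poly) \<Rightarrow> (nat \<Rightarrow> int poly) \<Rightarrow> bool" where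
  "proj u v u' v' \<longleftrightarrow> elem u' v' \<in> N\<^sub>1 \<and> elem (\<lambda>i. u i - u' i) (\<lambda>i. v i - v' i) \<in> N\<^sub>2"

lemma proj_ex: "\<exists>u' v'. proj u v u' v'"
proof -
  have "elem u v \<in> M" by (auto simp: M_def)
  then obtain y z where yz: "y \<in> N\<^sub>1" "z \<in> N\<^sub>2" "elem u v = y + z" using span by blast
  then have "y \<in> M" "z \<in> M" using N1 N2 by (auto simp: stable_def)
  then obtain u' v' where y: "y = elem u' v'" by (auto simp: M_def)
  have "elem u v - elem u' v' = z"
    using \<open>z \<in> M\<close> by (intro eq_vecI) (auto simp: yz(3) y M_def)
  then show ?thesis using yz y unfolding proj_def elem_diff[symmetric] by blast
qed

lemma proj_unique:
  assumes P: "proj u v u' v'" and Q: "proj a b a' b'" and eq: "elem u v = elem a b"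
  shows "elem u' v' = elem a' b'"
proof -
  let ?x = "elem u' v' - elem a' b'"
  have "?x \<in> N\<^sub>1" using P Q N1 by (auto simp: proj_def stable_def)
  moreover have "(elem a b - elem a' b') - (elem u v - elem u' v') \<in> N\<^sub>2"
    using P Q N2 by (auto simp: proj_def stable_def simp flip: elem_diff)
  moreover have "(elem a b - elem a' b') - (elem u v - elem u' v') = ?x"
    unfolding eq by (intro eq_vecI) auto
  ultimately have "?x = 0\<^sub>v (m * N)" using disj by auto
  then show ?thesis by (auto simp: vec_eq_iff)
qed

lemma proj_add: "proj u v u' v' \<Longrightarrow> proj a b a' b' \<Longrightarrow>
    proj (\<lambda>i. u i + a i) (\<lambda>i. v i + b i) (\<lambda>i. u' i + a' i) (\<lambda>i. v' i + b' i)"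
  using stable_elem_add[OF N1] stable_elem_add[OF N2]
  unfolding proj_def by (fastforce simp: add_diff_add)

lemma proj_0: "proj (\<lambda>i. 0) (\<lambda>i. 0) (\<lambda>i. 0) (\<lambda>i. 0)"
  using N1 N2 by (simp add: proj_def elem_0 stable_def)

lemma proj_mult: "proj u v u' v' \<Longrightarrow>
    proj (\<lambda>i. q * u i) (\<lambda>i. q * v i) (\<lambda>i. q * u' i) (\<lambda>i. q * v' i)"
  using stable_elem_mult[OF N1] stable_elem_mult[OF N2]
  unfolding proj_def by (simp flip: right_diff_distrib)

lemma proj_sum: "(\<And>c. proj (u c) (v c) (u' c) (v' c)) \<Longrightarrow>
    proj (\<lambda>i. \<Sum>c\<in>A. u c i) (\<lambda>i. \<Sum>c\<in>A. v c i) (\<lambda>i. \<Sum>c\<in>A. u' c i) (\<lambda>i. \<Sum>c\<in>A. v' c i)"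
  by (induction A rule: infinite_finite_induct) (simp_all add: proj_0 proj_add)

lemma proj_self: "elem u v \<in> N\<^sub>1 \<Longrightarrow> proj u v u v"
  using N2 by (simp add: proj_def elem_0 stable_def)

lemma proj_zero: "elem u v \<in> N\<^sub>2 \<Longrightarrow> proj u v (\<lambda>i. 0) (\<lambda>i. 0)"
  using N1 by (simp add: proj_def elem_0 stable_def)

lemma proj_cong:
  assumes P: "proj u v u' v'" and "elem u v = elem a b" "elem u' v' = elem a' b'"
  shows "proj a b a' b'"
  using assms unfolding proj_def elem_diff[symmetric] by simp

text \<open>
  The projection commutes with \<open>h\<close> and so preserves its kernel, the span of the \<open>b\<^sub>i\<close>.
\<close>

lemma proj_b_ex: "\<exists>w. proj (\<lambda>j. 0) v (\<lambda>j. 0) w"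
proof -
  obtain z w where P: "proj (\<lambda>j. 0) v z w" using proj_ex by blast
  have "elem (\<lambda>j. h * 0) (\<lambda>j. h * v j) = elem (\<lambda>j. 0) (\<lambda>j. 0)"
    by (simp add: elem_b_eq_iff)
  from proj_unique[OF proj_mult[OF P] proj_0 this]
  have "elem (\<lambda>j. h * z j) (\<lambda>j. h * w j) = 0\<^sub>v (m * N)" by (simp add: elem_0)
  then have "\<forall>j<m. f dvd z j"
    unfolding elem_eq_0_iff using f_dvd_of_dvd_h_mult by blast
  from proj_cong[OF P refl elem_move_carry[OF this]] show ?thesis by blast
qed

text \<open>
  The images of the generators are collected into matrices: the rows of \<open>U\<close> and \<open>V\<close> hold the
  coefficients of the image of \<open>a\<^sub>i\<close>, the rows of \<open>W\<close> those of the image of \<open>b\<^sub>i\<close>.  Since the projection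
  respects \<open>f a\<^sub>i = t b\<^sub>i + p b\<^sub>i\<^sub>+\<^sub>1\<close> and is idempotent, \<open>glue_idempotent_trivial\<close> applies to their
  transposes.
\<close>

lemma trivial_split: "N\<^sub>1 = {0\<^sub>v (m * N)} \<or> N\<^sub>2 = {0\<^sub>v (m * N)}"
proof -
  define e where "e i j = (of_bool (j = i) :: int poly)" for i j :: nat
  have sum_e: "(\<Sum>i<m. c i * e i j) = c j" if "j < m" for c j
  proof -
    have "(\<Sum>i<m. c i * e i j) = (\<Sum>i<m. if i = j then c j else 0)"
      by (intro sum.cong) (auto simp: e_def)
    then show ?thesis using that by simp
  qed
  have "\<forall>i. \<exists>u v. proj (e i) (\<lambda>j. 0) u v" "\<forall>i. \<exists>w. proj (\<lambda>j. 0) (e i) (\<lambda>j. 0) w"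
    using proj_ex proj_b_ex by blast+
  then obtain U V W where UV: "\<And>i. proj (e i) (\<lambda>j. 0) (U i) (V i)"
    and W: "\<And>i. proj (\<lambda>j. 0) (e i) (\<lambda>j. 0) (W i)"
    by metis
  have proj_elem: "proj u v (\<lambda>j. \<Sum>i<m. u i * U i j) (\<lambda>j. \<Sum>i<m. u i * V i j + v i * W i j)" for u v
  proof (rule proj_cong)
    show "proj (\<lambda>j. \<Sum>i<m. u i * e i j + v i * 0) (\<lambda>j. \<Sum>i<m. u i * 0 + v i * e i j)
        (\<lambda>j. \<Sum>i<m. u i * U i j + v i * 0) (\<lambda>j. \<Sum>i<m. u i * V i j + v i * W i j)"
      by (intro proj_sum proj_add proj_mult UV W)
    show "elem (\<lambda>j. \<Sum>i<m. u i * e i j + v i * 0) (\<lambda>j. \<Sum>i<m. u i * 0 + v i * e i j) = elem u v"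
      by (rule elem_cong) (simp_all add: sum_e)
  qed simp
  have proj_b: "proj (\<lambda>j. 0) v (\<lambda>j. 0) (\<lambda>j. \<Sum>i<m. v i * W i j)" for v
    using proj_elem[of "\<lambda>j. 0" v] by simp
  have defect: "h dvd glue_defect p m (\<lambda>j i. U i j) (\<lambda>j i. V i j) (\<lambda>j i. W i j) j i"
    if "i < m" "j < m" for i j
  proof -
    define v where "v j = t * e i j + of_nat p * e (Suc i) j" for j
    have v: "carry (\<lambda>j. f * e i j) j = v j" for j
      unfolding carry_f by (cases j) (auto simp: e_def v_def)
    have "elem (\<lambda>j. f * e i j) (\<lambda>j. f * 0) = elem (\<lambda>j. 0) v"
      using elem_move_carry[of "\<lambda>j. f * e i j" "\<lambda>j. f * 0"] by (simp add: v)
    from proj_unique[OF proj_mult[OF UV] proj_b this]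
    have "h dvd (f * V i j - (\<Sum>k<m. v k * W k j)) + carry (\<lambda>j. f * U i j) j"
      using that by (simp add: elem_eq_dvd_iff)
    also have "(\<Sum>k<m. v k * W k j) = t * W i j + (if Suc i < m then of_nat p * W (Suc i) j else 0)"
    proof -
      have "(\<Sum>k<m. v k * W k j) = (\<Sum>k<m. if k = i then t * W i j else 0)
          + (\<Sum>k<m. if k = Suc i then of_nat p * W (Suc i) j else 0)"
        unfolding sum.distrib[symmetric]
        by (intro sum.cong) (auto simp: v_def e_def)
      then show ?thesis using that by simp
    qed
    also have "f * V i j - (t * W i j + (if Suc i < m then of_nat p * W (Suc i) j else 0))
        + carry (\<lambda>j. f * U i j) j = - glue_defect p m (\<lambda>j i. U i j) (\<lambda>j i. V i j) (\<lambda>j i. W i j) j i"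
      unfolding carry_f glue_defect_def by simp
    finally show ?thesis by (simp only: dvd_minus_iff)
  qed
  have W_idem: "idem_mod m h (\<lambda>j i. W i j)"
    unfolding idem_mod_def
  proof (intro allI impI)
    fix j i assume "j < m" "i < m"
    have "elem (\<lambda>j. 0) (W i) \<in> N\<^sub>1" using W by (simp add: proj_def)
    from proj_unique[OF proj_b proj_self[OF this] refl]
    show "h dvd (\<Sum>k<m. W k j * W i k) - W i j"
      using \<open>j < m\<close> by (simp add: elem_b_eq_iff mult.commute)
  qed
  have U_idem: "idem_mod m f (\<lambda>j i. U i j)"
    unfolding idem_mod_def
  proof (intro allI impI)
    fix j i assume "j < m" "i < m"
    have "elem (U i) (V i) \<in> N\<^sub>1" using UV by (simp add: proj_def)
    from proj_unique[OF proj_elem proj_self[OF this] refl]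
    show "f dvd (\<Sum>k<m. U k j * U i k) - U i j"
      using \<open>j < m\<close> by (simp add: elem_eq_dvd_iff mult.commute)
  qed
  from glue_idempotent_trivial[OF p N' h_def m defect W_idem U_idem]
  consider (zero) "\<forall>i<m. \<forall>j<m. h dvd W j i \<and> f dvd U j i"
    | (one) "\<forall>i<m. \<forall>j<m. h dvd of_bool (i = j) - W j i \<and> f dvd of_bool (i = j) - U j i"
    by blast
  then show ?thesis
  proof cases
    case zero
    have "x = 0\<^sub>v (m * N)" if xN: "x \<in> N\<^sub>1" for x
    proof -
      obtain u v where x: "x = elem u v" using stable_elem[OF N1 xN] by blast
      let ?u = "\<lambda>j. \<Sum>i<m. u i * U i j" and ?v = "\<lambda>j. \<Sum>i<m. u i * V i j + v i * W i j"
      have uv: "elem u v = elem ?u ?v"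
        using proj_unique[OF proj_self proj_elem refl] xN x by blast
      have "\<forall>j<m. f dvd ?u j" using zero by (auto intro!: dvd_sum)
      from elem_move_carry[OF this] obtain w where w: "x = elem (\<lambda>j. 0) w"
        unfolding x uv by blast
      have "x = elem (\<lambda>j. 0) (\<lambda>j. \<Sum>i<m. w i * W i j)"
        using proj_unique[OF proj_self proj_b refl] xN w by blast
      also have "\<dots> = 0\<^sub>v (m * N)"
        using zero by (auto simp: elem_eq_0_iff carry_0 intro!: dvd_sum)
      finally show ?thesis .
    qed
    then show ?thesis using N1 by (auto simp: stable_def)
  next
    case one
    have sum_one: "g dvd (\<Sum>i<m. c i * A i j) - c j"
      if "\<forall>i<m. \<forall>j<m. g dvd of_bool (i = j) - A j i" "j < m" for g c j and A :: "nat \<Rightarrow> nat \<Rightarrow> int poly"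
    proof -
      have "g dvd (\<Sum>i<m. c i * (of_bool (j = i) - A i j))"
        using that by (intro dvd_sum) auto
      also have "(\<Sum>i<m. c i * (of_bool (j = i) - A i j)) = (\<Sum>i<m. c i * e i j) - (\<Sum>i<m. c i * A i j)"
        by (simp add: e_def right_diff_distrib sum_subtractf)
      finally have "g dvd - (c j - (\<Sum>i<m. c i * A i j))"
        unfolding sum_e[OF \<open>j < m\<close>] dvd_minus_iff .
      then show ?thesis by (simp only: minus_diff_eq)
    qed
    have "x = 0\<^sub>v (m * N)" if xN: "x \<in> N\<^sub>2" for x
    proof -
      obtain u v where x: "x = elem u v" using stable_elem[OF N2 xN] by blast
      let ?u = "\<lambda>j. \<Sum>i<m. u i * U i j" and ?v = "\<lambda>j. \<Sum>i<m. u i * V i j + v i * W i j"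
      have "elem ?u ?v = 0\<^sub>v (m * N)"
        using proj_unique[OF proj_elem proj_zero refl] xN x by (simp add: elem_0)
      then have "\<forall>j<m. f dvd ?u j" by (simp add: elem_eq_0_iff)
      then have "\<forall>j<m. f dvd u j" using sum_one[of f U _ u] one by (metis (no_types, lifting) dvd_diff_right_iff)
      from elem_move_carry[OF this] obtain w where w: "x = elem (\<lambda>j. 0) w"
        unfolding x by blast
      have "elem (\<lambda>j. 0) (\<lambda>j. \<Sum>i<m. w i * W i j) = 0\<^sub>v (m * N)"
        using proj_unique[OF proj_b proj_zero refl] xN w by (simp add: elem_0)
      then have "\<forall>j<m. h dvd (\<Sum>i<m. w i * W i j)" by (simp add: elem_eq_0_iff carry_0)
      then have "\<forall>j<m. h dvd w j" using sum_one[of h W _ w] one by (metis (no_types, lifting) dvd_diff_right_iff)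
      then show ?thesis by (simp add: w elem_eq_0_iff carry_0)
    qed
    then show ?thesis using N2 by (auto simp: stable_def)
  qed
qed

end

section \<open>A fixed vector and an invariant coordinate\<close>

context glued_module
begin

text \<open>
  The element \<open>(f / t) a\<^sub>m\<^sub>-\<^sub>1 - b\<^sub>m\<^sub>-\<^sub>1\<close>.  The last index is essential: there \<open>f a\<^sub>i\<close> is just \<open>t b\<^sub>i\<close>.
\<close>

definition fixvec :: "real vec" where
  "fixvec = elem (\<lambda>i. if i = m - 1 then geo 1 p else 0) (\<lambda>i. if i = m - 1 then -1 else 0)"

text \<open>
  The position of the constant coefficient at \<open>a\<^sub>m\<^sub>-\<^sub>1\<close>.
\<close>

definition inv_index :: nat where "inv_index = (m - 1) * N"

lemma inv_index: "inv_index < m * N" "inv_index div N = m - 1" "inv_index mod N = 0"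
  using index[of 0 "m - 1"] p_less_N m by (auto simp: inv_index_def)

lemma fixvec_carrier [simp]: "fixvec \<in> carrier_vec (m * N)"
  and dim_fixvec [simp]: "dim_vec fixvec = m * N"
  by (simp_all add: fixvec_def)

lemma fixvec_in_M: "fixvec \<in> M"
  by (auto simp: fixvec_def M_def)

lemma act_fixvec: "act k *\<^sub>v fixvec = fixvec"
proof -
  let ?e = "\<lambda>i. if i = m - 1 then 1 else 0 :: int poly"
  have t: "X 1 * (if i = m - 1 then geo 1 p else 0) - (if i = m - 1 then geo 1 p else 0) = f * ?e i" for i
    using geo_mult[of 1 p] by (simp add: left_diff_distrib)
  have "act 1 *\<^sub>v fixvec = fixvec"
    unfolding fixvec_def act_elem elem_eq_dvd_iff t carry_f by auto
  then show ?thesis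
  proof (induction k)
    case 0
    show ?case by (simp add: act_0)
  next
    case (Suc k)
    have "act (k + 1) *\<^sub>v fixvec = act k *\<^sub>v (act 1 *\<^sub>v fixvec)"
      unfolding act_add by (rule assoc_mult_mat_vec[of _ "m * N" "m * N" _ "m * N"]) auto
    then show ?case using Suc by simp
  qed
qed

lemma fixvec_inv_index: "fixvec $ inv_index = 1"
proof -
  have "degree (geo 1 p) < degree f"
    using monic_geo(2)[of 1 p] p1 by (simp add: degree_f)
  then have "remd f (geo 1 p) = geo 1 p" by (rule remd_small[OF f])
  moreover have "poly.coeff (geo 1 p) 0 = (\<Sum>j<p. if j = 0 then 1 else 0)"
    unfolding geo_def coeff_sum by (intro sum.cong) auto
  ultimately show ?thesis
    using inv_index p1 by (simp add: fixvec_def elem_index coord_def)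
qed

text \<open>
  For \<open>p | k\<close> the polynomial \<open>x\<^sup>k\<close> is \<open>1\<close> modulo \<open>f\<close>, so it fixes the coordinates at the \<open>a\<^sub>i\<close>.
\<close>

lemma act_inv_index:
  assumes "p dvd k" and x: "x \<in> carrier_vec (m * N)"
  shows "(act k *\<^sub>v x) $ inv_index = x $ inv_index"
proof -
  have fX: "f dvd X k - 1" using assms(1) xm1_dvd by (auto elim!: dvdE)
  have "remd f (X k * u) = remd f u" for u
  proof -
    have "f dvd (X k - 1) * u" using fX by simp
    then have "remd f ((X k - 1) * u) = 0" by (simp only: remd_eq_0_iff[OF f])
    moreover have "X k * u = (X k - 1) * u + u" by (simp add: algebra_simps)
    ultimately show ?thesis by (metis add_0 remd_add[OF f])
  qed
  then have "coord (\<lambda>i. X k * u i) (\<lambda>i. X k * v i) inv_index = coord u v inv_index" for u v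
    using inv_index p1 by (simp add: coord_def)
  then have row: "act k $$ (inv_index, c) = of_bool (inv_index = c)" if "c < m * N" for c
    using that inv_index by (simp add: act_def coord_gen)
  have "(act k *\<^sub>v x) $ inv_index = (\<Sum>c<m * N. act k $$ (inv_index, c) * x $ c)"
    using inv_index x by (simp add: act_def scalar_prod_def atLeast0LessThan)
  also have "\<dots> = (\<Sum>c<m * N. if c = inv_index then x $ inv_index else 0)"
    by (intro sum.cong) (auto simp: row)
  finally show ?thesis using inv_index by simp
qed

lemma act_mult_N: "N dvd k \<Longrightarrow> act k = 1\<^sub>m (m * N)"
  using act_mod[of k] by (simp add: act_0)

text \<open>
  If \<open>x\<^sup>k\<close> acts trivially, so does \<open>x\<^sup>d\<close> for \<open>d = gcd k N\<close>.  Then \<open>h\<close> divides \<open>x\<^sup>d - 1\<close>, which for a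
  proper divisor \<open>d\<close> of \<open>N\<close> has degree at most \<open>N / 2\<close>, less than the degree \<open>N - p\<close> of \<open>h\<close>.
\<close>

lemma act_faithful:
  assumes "\<And>x. x \<in> M \<Longrightarrow> act k *\<^sub>v x = x"
  shows "N dvd k"
proof (rule ccontr)
  assume nd: "\<not> N dvd k"
  have act_k: "act k = 1\<^sub>m (m * N)"
    using assms by (intro mat_eqI_elem) (auto simp: M_def)
  have act_mult: "act (k * n) = 1\<^sub>m (m * N)" for n
    by (induction n) (simp_all add: act_0 act_add act_k)
  define d where "d = gcd k N"
  have "k \<noteq> 0" using nd by (cases "k = 0") auto
  then obtain a b where ab: "k * a = N * b + d"
    using bezout_nat[of k N] by (auto simp: d_def)
  have "act (k * a) = act (N * b) * act d"
    unfolding ab act_add ..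
  then have act_d: "act d = 1\<^sub>m (m * N)"
    by (simp add: act_mult act_mult_N left_mult_one_mat[OF act_carrier])
  have N0: "N > 0" using p_less_N by simp
  have "d dvd N" by (simp add: d_def)
  then obtain c where c: "N = d * c" by (elim dvdE)
  have "d \<noteq> N" using nd by (metis d_def gcd_dvd1)
  then have "c \<noteq> 1" "c \<noteq> 0" using c N0 by auto
  then have "2 \<le> c" by linarith
  then have d2: "2 * d \<le> N" using c by simp
  have d0: "d > 0" using \<open>k \<noteq> 0\<close> by (simp add: d_def)
  let ?b = "\<lambda>j. of_bool (j = 0) :: int poly"
  have "elem (\<lambda>j. X d * 0) (\<lambda>j. X d * ?b j) = elem (\<lambda>j. 0) ?b"
    using act_elem[of d "\<lambda>j. 0" ?b] by (simp add: act_d)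
  then have "\<forall>j<m. h dvd X d * ?b j - ?b j" by (simp only: elem_b_eq_iff mult_zero_right)
  from this[rule_format, OF m] have "h dvd xm1 d" by simp
  moreover have "xm1 d \<noteq> 0" using monic_xm1[OF d0] by (auto simp: monic_nonconst_def)
  ultimately have "degree h \<le> degree (xm1 d)" by (rule dvd_imp_degree_le)
  then have "N - p \<le> d" using degree_h degree_xm1[OF d0] by simp
  then have "N \<le> 2 * p" using d2 p_less_N by simp
  moreover have "2 * p < N"
  proof -
    have "2 * 2 \<le> p * p" using p1 by (intro mult_le_mono) auto
    then have "2 < p * p" by simp
    then have "2 * p < p * p * p" using p1 by (intro mult_strict_right_mono) auto
    also have "\<dots> \<le> p * p * p * N'" using N' by simp
    finally show ?thesis by (simp add: N_def power3_eq_cube)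
  qed
  ultimately show False by simp
qed

lemma M_carrier: "x \<in> M \<Longrightarrow> x \<in> carrier_vec (m * N)"
  by (auto simp: M_def)

lemma M_add: "x \<in> M \<Longrightarrow> y \<in> M \<Longrightarrow> x + y \<in> M"
  by (auto simp: M_iff)

lemma M_act: "x \<in> M \<Longrightarrow> act k *\<^sub>v x \<in> M"
  unfolding M_def by (clarsimp simp: act_elem) blast

lemma act_zero: "act k *\<^sub>v 0\<^sub>v (m * N) = 0\<^sub>v (m * N)"
  unfolding elem_0[symmetric] act_elem by simp

lemma M_0: "0\<^sub>v (m * N) \<in> M"
  by (simp add: M_iff)

lemma M_add_int_fixvec: "x \<in> M \<Longrightarrow> x + real_of_int e \<cdot>\<^sub>v fixvec \<in> M"
  using fixvec_in_M by (auto simp: M_iff)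

lemma act_affine:
  assumes "x \<in> carrier_vec (m * N)"
  shows "act k *\<^sub>v (x + s \<cdot>\<^sub>v fixvec) = act k *\<^sub>v x + s \<cdot>\<^sub>v fixvec"
  using assms by (simp add: mult_add_distrib_mat_vec[OF act_carrier] mult_mat_vec[OF act_carrier] act_fixvec)

definition transl :: "nat \<Rightarrow> real vec set" where
  "transl k = {x + (real k / real N) \<cdot>\<^sub>v fixvec | x. x \<in> M}"

lemma zero_in_transl: "0\<^sub>v (m * N) + (real k / real N) \<cdot>\<^sub>v fixvec \<in> transl k"
  unfolding transl_def using M_0 by blast

lemma transl_carrier: "y \<in> transl k \<Longrightarrow> y \<in> carrier_vec (m * N)"
  by (auto simp: transl_def dest: M_carrier)

lemma transl_inv_index: "y \<in> transl k \<Longrightarrow> y $ inv_index - real k / real N \<in> \<int>"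
  using inv_index(1) by (auto simp: transl_def M_iff fixvec_inv_index)

lemma dvd_of_fraction_Ints:
  assumes "real k / real N \<in> \<int>"
  shows "N dvd k"
proof -
  obtain e where "real k / real N = real_of_int e" using assms by (elim Ints_cases)
  moreover have N0: "N > 0" using p_less_N by simp
  ultimately have "real k = real_of_int (int N * e)" by (simp add: field_simps)
  then have "int k = int N * e" by (metis of_int_eq_iff of_int_of_nat_eq)
  then have "int N dvd int k" by simp
  then show ?thesis by (simp add: int_dvd_int_iff)
qed

text \<open>
  The cocycle identity, with exponents that add up only modulo \<open>N\<close>: the discrepancy is an integer
  multiple of the fixed vector, which lies in the lattice.
\<close>

lemma transl_mult:
  assumes c: "int c = int a + int b + int N * e"
  shows "transl c = {act a *\<^sub>v y + x | x y. x \<in> transl a \<and> y \<in> transl b}"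
proof -
  have N0: "N > 0" using p_less_N by simp
  have "real c = real a + real b + real N * real_of_int e"
    using c by (metis of_int_add of_int_mult of_int_of_nat_eq)
  then have cN: "real c / real N = real a / real N + real b / real N + real_of_int e"
    using N0 by (simp add: field_simps)
  show ?thesis
  proof (intro equalityI subsetI)
    fix y assume "y \<in> transl c"
    then obtain x where x: "x \<in> M" "y = x + (real c / real N) \<cdot>\<^sub>v fixvec" by (auto simp: transl_def)
    have 1: "(x + real_of_int e \<cdot>\<^sub>v fixvec) + (real a / real N) \<cdot>\<^sub>v fixvec \<in> transl a"
      unfolding transl_def using M_add_int_fixvec[OF x(1)] by blast
    have 2: "0\<^sub>v (m * N) + (real b / real N) \<cdot>\<^sub>v fixvec \<in> transl b"
      by (rule zero_in_transl)
    have "y = act a *\<^sub>v (0\<^sub>v (m * N) + (real b / real N) \<cdot>\<^sub>v fixvec)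
        + ((x + real_of_int e \<cdot>\<^sub>v fixvec) + (real a / real N) \<cdot>\<^sub>v fixvec)"
      unfolding act_affine[OF zero_carrier_vec] act_zero x(2) cN
      using M_carrier[OF x(1)]
      by (intro eq_vecI) (auto simp: algebra_simps)
    with 1 2 show "y \<in> {act a *\<^sub>v y + x | x y. x \<in> transl a \<and> y \<in> transl b}" by blast
  next
    fix z assume "z \<in> {act a *\<^sub>v y + x | x y. x \<in> transl a \<and> y \<in> transl b}"
    then obtain x y where xy: "x \<in> M" "y \<in> M"
      and z: "z = act a *\<^sub>v (y + (real b / real N) \<cdot>\<^sub>v fixvec) + (x + (real a / real N) \<cdot>\<^sub>v fixvec)"
      by (auto simp: transl_def)
    have ay: "act a *\<^sub>v y \<in> M" using xy M_act by blast
    have "(act a *\<^sub>v y + x) + real_of_int (- e) \<cdot>\<^sub>v fixvec \<in> M"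
      using M_add_int_fixvec M_add[OF ay xy(1)] by blast
    moreover have "z = ((act a *\<^sub>v y + x) + real_of_int (- e) \<cdot>\<^sub>v fixvec) + (real c / real N) \<cdot>\<^sub>v fixvec"
      unfolding z act_affine[OF M_carrier[OF xy(2)]] cN
      using M_carrier[OF xy(1)] M_carrier[OF ay]
      by (intro eq_vecI) (auto simp: algebra_simps)
    ultimately show "z \<in> transl c" unfolding transl_def by blast
  qed
qed

end

section \<open>The crystallographic group\<close>

text \<open>
  The generator \<open>a\<close> acts as multiplication by \<open>x\<close>.
\<close>

locale cyclic_glued = glued_module p N' m + group G
  for p N' m :: nat and G (structure) +
  fixes a
  assumes a: "a \<in> carrier G" and gen: "\<And>g. g \<in> carrier G \<Longrightarrow> \<exists>k::nat. g = a [^] k"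
    and ord_a: "ord a = N"
begin

definition dlog :: "_ \<Rightarrow> nat" where "dlog g = (SOME k. g = a [^] k)"

lemma dlog: "g \<in> carrier G \<Longrightarrow> a [^] dlog g = g"
  unfolding dlog_def using gen by (metis (mono_tags, lifting) someI_ex)

lemma pow_eq_iff: "a [^] (k::nat) = a [^] (l::nat) \<longleftrightarrow> int N dvd int l - int k"
  using int_pow_eq[OF a, of "int k" "int l"] by (simp add: int_pow_int ord_a)

lemma dlog_pow: "int N dvd int (dlog (a [^] (k::nat))) - int k"
  using dlog[of "a [^] k"] a pow_eq_iff[of k "dlog (a [^] k)"] by simp

lemma dlog_mult:
  assumes "g \<in> carrier G" "g' \<in> carrier G"
  shows "\<exists>e. int (dlog (g \<otimes> g')) = int (dlog g) + int (dlog g') + int N * e"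
proof -
  have "a [^] (dlog g + dlog g') = g \<otimes> g'"
    using assms dlog a by (simp add: nat_pow_mult[symmetric])
  then have "int N dvd int (dlog (g \<otimes> g')) - int (dlog g + dlog g')"
    using dlog_pow[of "dlog g + dlog g'"] by simp
  then obtain e where "int (dlog (g \<otimes> g')) - int (dlog g + dlog g') = int N * e" by (elim dvdE)
  then show ?thesis by (intro exI[of _ e]) simp
qed

lemma dlog_one: "N dvd dlog \<one>"
  using dlog_pow[of 0] by (simp add: int_dvd_int_iff)

definition \<rho> :: "_ \<Rightarrow> real mat" where "\<rho> g = act (dlog g)"
definition T :: "_ \<Rightarrow> real vec set" where "T g = transl (dlog g)"

lemma act_cong: "int N dvd int k - int l \<Longrightarrow> act k = act l"
  using act_mod[of k] act_mod[of l] by (metis mod_eq_dvd_iff of_nat_eq_iff zmod_int)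

lemma \<rho>_one: "\<rho> \<one> = 1\<^sub>m (m * N)"
  using act_mult_N[OF dlog_one] by (simp add: \<rho>_def)

lemma \<rho>_mult:
  assumes "g \<in> carrier G" "g' \<in> carrier G"
  shows "\<rho> (g \<otimes> g') = \<rho> g * \<rho> g'"
proof -
  obtain e where "int (dlog (g \<otimes> g')) = int (dlog g) + int (dlog g') + int N * e"
    using dlog_mult[OF assms] by blast
  then have "act (dlog (g \<otimes> g')) = act (dlog g + dlog g')" by (intro act_cong) simp
  then show ?thesis by (simp add: \<rho>_def act_add)
qed

lemma lattice: "ZG_lattice G (m * N) \<rho> M"
  unfolding ZG_lattice_def using full_lattice_M \<rho>_one \<rho>_mult M_act by (simp add: \<rho>_def)

lemma faithful: "faithful_on G \<rho> M"
  unfolding faithful_on_def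
proof (intro ballI impI)
  fix g assume g: "g \<in> carrier G" and "\<forall>x\<in>M. \<rho> g *\<^sub>v x = x"
  then have "N dvd dlog g" using act_faithful by (simp add: \<rho>_def)
  then have "a [^] dlog g = \<one>" using pow_eq_id[OF a] ord_a by simp
  then show "g = \<one>" using dlog[OF g] by simp
qed

lemma coset: "transl k = M #>\<^bsub>RM (m * N)\<^esub> ((real k / real N) \<cdot>\<^sub>v fixvec)"
  by (auto simp: transl_def r_coset_def monoid_vec_simps)

lemma cocycle: "cocycle G (m * N) \<rho> M T"
  unfolding cocycle_def
proof (intro conjI ballI funcsetI)
  fix g assume "g \<in> carrier G"
  show "T g \<in> carrier (RM (m * N) Mod M)"
    unfolding T_def coset FactGroup_def RCOSETS_def by (auto simp: monoid_vec_simps)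
next
  fix g g' assume g: "g \<in> carrier G" "g' \<in> carrier G"
  obtain e where e: "int (dlog (g \<otimes> g')) = int (dlog g) + int (dlog g') + int N * e"
    using dlog_mult[OF g] by blast
  show "T (g \<otimes> g') = coset_act \<rho> g (T g') \<otimes>\<^bsub>RM (m * N) Mod M\<^esub> T g"
    unfolding T_def transl_mult[OF e]
    by (auto simp: coset_act_def FactGroup_def set_mult_def monoid_vec_simps \<rho>_def)
qed

lemma finite_G: "finite (carrier G)"
proof -
  have "carrier G \<subseteq> (\<lambda>k. a [^] k) ` {..<N}"
  proof
    fix g assume "g \<in> carrier G"
    then have "g = a [^] (dlog g mod N)"
      using dlog[of g] pow_eq_iff[of "dlog g" "dlog g mod N"]
      by (simp add: of_nat_mod mod_eq_dvd_iff[symmetric])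
    then show "g \<in> (\<lambda>k. a [^] k) ` {..<N}" using offset_less by blast
  qed
  then show ?thesis using finite_surj by blast
qed

lemma cryst: "crystallographic G (m * N) \<rho> M T"
  unfolding crystallographic_def using lattice faithful cocycle finite_G is_group by blast

lemma Crys_pow_fst:
  "fst ((g, x) [^]\<^bsub>Crys G (m * N) \<rho> T\<^esub> (k::nat)) = g [^] k"
  by (induction k) (auto simp: Crys_def nat_pow_def split: prod.splits)

text \<open>
  On a coordinate that is invariant under the linear part, the translation parts add up.
\<close>

lemma Crys_pow_coord:
  assumes gx: "(g, x) \<in> carrier (Crys G (m * N) \<rho> T)" and r: "r < m * N"
    and inv: "\<And>y. y \<in> carrier_vec (m * N) \<Longrightarrow> (\<rho> g *\<^sub>v y) $ r = y $ r"
  shows "snd ((g, x) [^]\<^bsub>Crys G (m * N) \<rho> T\<^esub> (k::nat)) $ r = real k * x $ r"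
proof -
  interpret C: group "Crys G (m * N) \<rho> T" by (rule Crys_group[OF cryst])
  have x: "x \<in> carrier_vec (m * N)" using gx transl_carrier by (auto simp: Crys_def T_def)
  show ?thesis
  proof (induction k)
    case 0
    show ?case using r by (simp add: Crys_def nat_pow_def)
  next
    case (Suc k)
    let ?z = "(g, x) [^]\<^bsub>Crys G (m * N) \<rho> T\<^esub> k"
    obtain g' y where z: "?z = (g', y)" by force
    have "?z \<in> carrier (Crys G (m * N) \<rho> T)" using gx by simp
    then have y: "y \<in> carrier_vec (m * N)"
      using z transl_carrier by (auto simp: Crys_def T_def)
    have "(g, x) [^]\<^bsub>Crys G (m * N) \<rho> T\<^esub> Suc k = (g, x) \<otimes>\<^bsub>Crys G (m * N) \<rho> T\<^esub> ?z"
      using gx by (rule C.nat_pow_Suc2)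
    also have "\<dots> = (g \<otimes> g', \<rho> g *\<^sub>v y + x)" by (simp add: z) (simp add: Crys_def)
    finally show ?case using Suc inv[OF y] x r z by (simp add: algebra_simps)
  qed
qed

text \<open>
  The elements over the identity form a lattice.  Any other element has a power over some \<open>x\<^sup>i\<close> of prime
  order \<open>q\<close>, so \<open>N | i q\<close> but not \<open>N | i\<close>.  Since \<open>p\<^sup>2 | N\<close>, this forces \<open>p | i\<close>, and the invariant
  coordinate, which lies in \<open>i / N + \<int>\<close>, is nonzero and additive on the powers.
\<close>

lemma torsionfree: "torsionfree (Crys G (m * N) \<rho> T)"
  unfolding torsionfree_def
proof (intro ballI allI impI)
  interpret C: group "Crys G (m * N) \<rho> T" by (rule Crys_group[OF cryst])
  fix z and k :: nat
  assume z: "z \<in> carrier (Crys G (m * N) \<rho> T)"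
    and k: "0 < k \<and> z [^]\<^bsub>Crys G (m * N) \<rho> T\<^esub> k = \<one>\<^bsub>Crys G (m * N) \<rho> T\<^esub>"
  obtain g x where gx: "z = (g, x)" by force
  have g: "g \<in> carrier G" and x: "x \<in> T g" using z by (auto simp: gx Crys_def)
  have one: "\<one>\<^bsub>Crys G (m * N) \<rho> T\<^esub> = (\<one>, 0\<^sub>v (m * N))" by (simp add: Crys_def)
  show "z = \<one>\<^bsub>Crys G (m * N) \<rho> T\<^esub>"
  proof (cases "g = \<one>")
    case True
    have xc: "x \<in> carrier_vec (m * N)" using x transl_carrier by (auto simp: T_def)
    have "x $ r = 0" if r: "r < m * N" for r
    proof -
      have "snd (z [^]\<^bsub>Crys G (m * N) \<rho> T\<^esub> k) $ r = real k * x $ r"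
        unfolding gx using z r gx by (intro Crys_pow_coord) (auto simp: True \<rho>_one)
      then show ?thesis using k r by (simp add: one)
    qed
    then have "x = 0\<^sub>v (m * N)" using xc by (intro eq_vecI) auto
    then show ?thesis by (simp add: gx True one)
  next
    case False
    then have "ord g \<noteq> 1" using ord_eq_1[OF g] by simp
    then obtain q where q: "prime q" "q dvd ord g" using prime_factor_nat by blast
    then obtain s where s: "ord g = q * s" by (elim dvdE)
    define i where "i = dlog g * s"
    have pow: "g [^] l = a [^] (dlog g * l)" for l :: nat
      using dlog[OF g] a by (metis nat_pow_pow)
    have "s \<noteq> 0" using s ord_ge_1[OF finite_G g] by (cases "s = 0") auto
    moreover have "q > 1" using q prime_gt_1_nat by blast
    ultimately have "\<not> ord g dvd s" using s by (auto dest: dvd_imp_le)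
    then have "g [^] s \<noteq> \<one>" using pow_eq_id[OF g] by blast
    then have ni: "\<not> N dvd i" unfolding pow i_def[symmetric] using pow_eq_id[OF a] ord_a by simp
    have "g [^] (s * q) = \<one>" using pow_eq_id[OF g] s by (simp add: mult.commute)
    then have "N dvd i * q" unfolding pow i_def using pow_eq_id[OF a] ord_a by (simp add: mult.assoc)
    then have "p * p dvd i * q"
      by (rule dvd_trans[rotated]) (simp add: N_def power3_eq_cube)
    have pi: "p dvd i"
    proof (cases "q = p")
      case True
      then show ?thesis using \<open>p * p dvd i * q\<close> p1 by simp
    next
      case False
      then have "\<not> p dvd q" using p q(1) primes_dvd_imp_eq by blast
      then show ?thesis using \<open>p * p dvd i * q\<close> p by (meson dvd_mult_left prime_dvd_mult_iff)
    qed
    let ?z = "z [^]\<^bsub>Crys G (m * N) \<rho> T\<^esub> s"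
    obtain g' y where gy: "?z = (g', y)" by force
    have zc: "?z \<in> carrier (Crys G (m * N) \<rho> T)" using z by simp
    have g': "g' = a [^] i" using Crys_pow_fst[of g x s] gx gy pow by (simp add: i_def)
    have y: "y \<in> transl (dlog g')" using zc gy by (simp add: Crys_def T_def)
    have N_dlog: "int N dvd int (dlog g') - int i" using dlog_pow[of i] g' by simp
    have "\<rho> g' = act i" using act_cong[OF N_dlog] by (simp add: \<rho>_def)
    then have "snd (?z [^]\<^bsub>Crys G (m * N) \<rho> T\<^esub> k) $ inv_index = real k * y $ inv_index"
      unfolding gy using zc gy inv_index(1) act_inv_index[OF pi] by (intro Crys_pow_coord) auto
    moreover have "?z [^]\<^bsub>Crys G (m * N) \<rho> T\<^esub> k = \<one>\<^bsub>Crys G (m * N) \<rho> T\<^esub>"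
      using k C.nat_pow_pow[OF z] C.nat_pow_one by (metis mult.commute)
    ultimately have "y $ inv_index = 0" using k inv_index by (simp add: one)
    then have "- (real (dlog g') / real N) \<in> \<int>" using transl_inv_index[OF y] by simp
    then have "N dvd dlog g'" by (intro dvd_of_fraction_Ints) (simp only: minus_in_Ints_iff)
    then have "int N dvd int i" using N_dlog by (simp add: dvd_diff_right_iff)
    then have "N dvd i" by (simp add: int_dvd_int_iff)
    with ni show ?thesis by blast
  qed
qed

text \<open>
  A coboundary vanishes at \<open>x\<^sup>p\<close> on the invariant coordinate, whereas this cocycle takes values in
  \<open>p / N + \<int>\<close>, which contains no integer.
\<close>

lemma not_coboundary: "\<not> coboundary G (m * N) \<rho> M T"
proof
  assume "coboundary G (m * N) \<rho> M T"
  then obtain z where z: "z \<in> carrier (RM (m * N) Mod M)"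
    and T: "\<And>g. g \<in> carrier G \<Longrightarrow>
      T g = coset_act \<rho> g z \<otimes>\<^bsub>RM (m * N) Mod M\<^esub> inv\<^bsub>RM (m * N) Mod M\<^esub> z"
    unfolding coboundary_def by blast
  interpret R: comm_group "RM (m * N)" by (rule comm_group_vec)
  interpret Mn: normal M "RM (m * N)"
    using R.subgroup_imp_normal[OF full_lattice_subgroup[OF full_lattice_M]] .
  obtain c where c: "c \<in> carrier_vec (m * N)" and zc: "z = M #>\<^bsub>RM (m * N)\<^esub> c"
    using z by (auto simp: FactGroup_def RCOSETS_def monoid_vec_simps)
  have inv: "inv\<^bsub>RM (m * N)\<^esub> y = - y" if "y \<in> carrier_vec (m * N)" for y
    by (rule R.inv_equality) (use that in \<open>auto simp: monoid_vec_simps\<close>)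
  let ?g = "a [^] p"
  have g: "?g \<in> carrier G" using a by simp
  have "(real (dlog ?g) / real N) \<cdot>\<^sub>v fixvec \<in> T ?g"
  proof -
    have "0\<^sub>v (m * N) + (real (dlog ?g) / real N) \<cdot>\<^sub>v fixvec \<in> transl (dlog ?g)"
      by (rule zero_in_transl)
    then show ?thesis by (simp add: T_def)
  qed
  then obtain y y' where yz: "y \<in> z" "y' \<in> z"
    and eq: "(real (dlog ?g) / real N) \<cdot>\<^sub>v fixvec = \<rho> ?g *\<^sub>v y + inv\<^bsub>RM (m * N)\<^esub> y'"
    unfolding T[OF g] Mn.inv_FactGroup[OF z]
    by (auto simp: FactGroup_def set_mult_def SET_INV_def coset_act_def monoid_vec_simps)
  have carr: "y \<in> carrier_vec (m * N)" "y' \<in> carrier_vec (m * N)"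
    and int: "y $ inv_index - y' $ inv_index \<in> \<int>"
    using yz c inv_index(1) by (auto simp: zc r_coset_def monoid_vec_simps M_iff)
  have "p dvd dlog ?g"
  proof -
    have "int p dvd int N" by (simp add: N_def power3_eq_cube)
    then have "int p dvd int (dlog ?g) - int p" using dlog_pow[of p] by (rule dvd_trans)
    then have "int p dvd int (dlog ?g)" by (simp add: dvd_diff_left_iff)
    then show ?thesis by (simp add: int_dvd_int_iff)
  qed
  then have "(\<rho> ?g *\<^sub>v y) $ inv_index = y $ inv_index" unfolding \<rho>_def using act_inv_index carr by blast
  then have "((real (dlog ?g) / real N) \<cdot>\<^sub>v fixvec) $ inv_index = y $ inv_index - y' $ inv_index"
    unfolding eq inv[OF carr(2)] using carr inv_index(1) by (simp add: \<rho>_def)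
  then have "real (dlog ?g) / real N \<in> \<int>"
    using int inv_index(1) fixvec_carrier by (simp add: fixvec_inv_index)
  then have "N dvd dlog ?g" by (rule dvd_of_fraction_Ints)
  then have "int N dvd int p" using dlog_pow[of p] by (simp add: dvd_diff_right_iff)
  then have "N dvd p" by (simp add: int_dvd_int_iff)
  then show False using p_less_N p1 by (auto dest: dvd_imp_le)
qed

lemma stable_submodule:
  assumes "ZG_submodule G (m * N) \<rho> M K"
  shows "stable K"
proof -
  interpret R: comm_group "RM (m * N)" by (rule comm_group_vec)
  have KM: "K \<subseteq> M" and sub: "subgroup K (RM (m * N))"
    and act: "\<And>g x. g \<in> carrier G \<Longrightarrow> x \<in> K \<Longrightarrow> \<rho> g *\<^sub>v x \<in> K"
    using assms by (auto simp: ZG_submodule_def)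
  have carr: "x \<in> carrier_vec (m * N)" if "x \<in> K" for x using that KM M_carrier by blast
  have add: "x + y \<in> K" if "x \<in> K" "y \<in> K" for x y
    using subgroup.m_closed[OF sub that] by (simp add: monoid_vec_simps)
  have "x - y \<in> K" if "x \<in> K" "y \<in> K" for x y
  proof -
    have "inv\<^bsub>RM (m * N)\<^esub> y = - y"
      by (rule R.inv_equality) (use carr[OF that(2)] in \<open>auto simp: monoid_vec_simps\<close>)
    then have "- y \<in> K" using subgroup.m_inv_closed[OF sub that(2)] by simp
    then have "x + - y \<in> K" using add that by blast
    moreover have "x + - y = x - y" using carr that by (intro eq_vecI) auto
    ultimately show ?thesis by simp
  qed
  moreover have "act 1 *\<^sub>v x \<in> K" if "x \<in> K" for x
  proof -
    from act[OF nat_pow_closed[OF a, of 1] that] show ?thesis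
      unfolding \<rho>_def act_cong[OF dlog_pow] .
  qed
  moreover have "0\<^sub>v (m * N) \<in> K" using subgroup.one_closed[OF sub] by (simp add: monoid_vec_simps)
  ultimately show ?thesis using KM add by (auto simp: stable_def)
qed

lemma indecomposable: "indecomposable_module G (m * N) \<rho> M"
  unfolding indecomposable_module_def
proof (intro conjI allI impI)
  show "M \<noteq> {0\<^sub>v (m * N)}"
  proof
    assume "M = {0\<^sub>v (m * N)}"
    then have "fixvec = 0\<^sub>v (m * N)" using fixvec_in_M by simp
    then show False using fixvec_inv_index inv_index(1) by simp
  qed
next
  fix N\<^sub>1 N\<^sub>2
  assume *: "ZG_submodule G (m * N) \<rho> M N\<^sub>1 \<and> ZG_submodule G (m * N) \<rho> M N\<^sub>2 \<and>
    N\<^sub>1 \<inter> N\<^sub>2 = {0\<^sub>v (m * N)} \<and> N\<^sub>1 <#>\<^bsub>RM (m * N)\<^esub> N\<^sub>2 = M"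
  interpret split_glued_module p N' m N\<^sub>1 N\<^sub>2
  proof unfold_locales
    show "stable N\<^sub>1" "stable N\<^sub>2" using * stable_submodule by blast+
    show "N\<^sub>1 \<inter> N\<^sub>2 = {0\<^sub>v (m * N)}" using * by blast
    fix x assume "x \<in> M"
    then have "x \<in> N\<^sub>1 <#>\<^bsub>RM (m * N)\<^esub> N\<^sub>2" using * by blast
    then show "\<exists>y\<in>N\<^sub>1. \<exists>z\<in>N\<^sub>2. x = y + z" by (auto simp: set_mult_def monoid_vec_simps)
  qed
  show "N\<^sub>1 = {0\<^sub>v (m * N)} \<or> N\<^sub>2 = {0\<^sub>v (m * N)}" by (rule trivial_split)
qed

end

theorem theorem1:
  fixes G :: "('g, 'b) monoid_scheme"
    and s m :: nat
    and p n :: "nat \<Rightarrow> nat"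
  assumes "group G" and "cyclic_group G"
    and "s \<ge> 1"
    and "\<forall>i\<in>{1..s}. prime (p i)"
    and "inj_on p {1..s}"
    and "Coset.order G = (\<Prod>i=1..s. p i ^ n i)"
    and "n 1 \<ge> 3"
    and "\<forall>i\<in>{2..s}. n i \<ge> 2"
    and "coprime m (Coset.order G)"
  shows "\<exists>\<rho> M T.
           indecomposable_crystallographic G (m * Coset.order G) \<rho> M T \<and>
           torsionfree (Crys G (m * Coset.order G) \<rho> T)"
proof -
  interpret group G by fact
  let ?p = "p 1"
  have 1: "1 \<in> {1..s}" using \<open>s \<ge> 1\<close> by simp
  then have prime: "prime ?p" using assms(4) by blast
  have pos: "Coset.order G > 0"
    using assms(4,6) prime_gt_0_nat by (auto intro!: prod_pos)
  have "?p ^ 3 dvd ?p ^ n 1" using \<open>n 1 \<ge> 3\<close> by (rule le_imp_power_dvd)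
  also have "\<dots> dvd Coset.order G" unfolding assms(6) using 1 by (intro dvd_prodI) auto
  finally have dvd: "?p ^ 3 dvd Coset.order G" .
  then obtain N' where N': "Coset.order G = ?p ^ 3 * N'" by (elim dvdE)
  have "m > 0"
  proof (rule ccontr)
    assume "\<not> m > 0"
    then have "is_unit (Coset.order G)" using assms(9) by simp
    then have "is_unit (?p ^ 3)" using dvd dvd_unit_imp_unit by blast
    then show False using prime by (simp add: is_unit_power_iff)
  qed
  have fin: "finite (carrier G)" using pos by (simp add: order_gt_0_iff_finite)
  obtain a where a: "a \<in> carrier G" and gen: "subgroup_generated G {a} = G"
    using assms(2) by (auto simp: cyclic_group_def)
  have gen_a: "generate G {a} = carrier G"
    using a gen by (metis carrier_subgroup_generated inf.absorb_iff2 empty_subsetI insert_subset)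
  have ord: "ord a = Coset.order G"
    using generate_pow_card[OF a] gen_a by (simp add: Coset.order_def)
  interpret g: glued_module ?p N' m
    by unfold_locales (use prime pos N' \<open>m > 0\<close> in \<open>auto intro: Nat.gr0I\<close>)
  have N: "g.N = Coset.order G" unfolding N' by (rule g.N_def)
  interpret cyclic_glued ?p N' m G a
  proof unfold_locales
    show "a \<in> carrier G" by fact
    show "ord a = g.N" using ord N by simp
    fix g assume "g \<in> carrier G"
    then show "\<exists>k::nat. g = a [^]\<^bsub>G\<^esub> k"
      using generate_pow_nat[OF a] gen_a ord pos by auto
  qed
  show ?thesis
    using cryst not_coboundary indecomposable torsionfree
    unfolding indecomposable_crystallographic_def N by blast
qed

end
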